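(* Let $\mathrm{A}$ be a complex $3$-dimensional $(-1,1)$-algebra with nonzero multiplication. Then $\mathrm{A}$ is isomorphic to one of the right alternative algebras $\mathrm{A}_{01},\dots,\mathrm{A}_{11}$, $\mathrm{R}_{00}$, $\mathrm{R}_{01}$, $\mathrm{R}_{02}^{\alpha}$ ($\alpha\in\mathbb{C}$, $\alpha\neq0$), $\mathrm{R}_{03},\dots,\mathrm{R}_{16}$ listed in the context.
   Context: Write $(x,y,z)=(xy)z-x(yz)$. An algebra is right alternative if $(x,y,z)=-(x,z,y)$ for all $x,y,z$. A $(-1,1)$-algebra is a right alternative algebra satisfying $(x,y,z)+(y,z,x)+(z,x,y)=0$ for all $x,y,z$. The algebras below are given in a basis $e_1,e_2,e_3$. For $\mathrm{A}_{01},\dots,\mathrm{A}_{11}$ the multiplication is commutative, and products neither listed nor obtained from listed ones by commutativity are zero; for the others all products not listed are zero. $\mathrm{A}_{01}$: $e_1e_1=e_1$, $e_2e_2=e_2$; $\mathrm{A}_{02}$: $e_1e_1=e_1$, $e_1e_2=e_2$; $\mathrm{A}_{03}$: $e_1e_1=e_1$; $\mathrm{A}_{04}$: $e_1e_1=e_2$; $\mathrm{A}_{05}$: $e_1e_2=e_3$; $\mathrm{A}_{06}$: $e_1e_1=e_2$, $e_1e_2=e_3$; $\mathrm{A}_{07}$: $e_1e_1=e_1$, $e_2e_2=e_2$, $e_3e_3=e_3$; $\mathrm{A}_{08}$: $e_1e_1=e_1$, $e_2e_2=e_2$, $e_2e_3=e_3$; $\mathrm{A}_{09}$: $e_1e_1=e_1$,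 $e_1e_2=e_2$, $e_1e_3=e_3$; $\mathrm{A}_{10}$: $e_1e_1=e_1$, $e_1e_2=e_2$, $e_1e_3=e_3$, $e_2e_2=e_3$; $\mathrm{A}_{11}$: $e_1e_1=e_1$, $e_2e_2=e_3$; $\mathrm{R}_{00}$: $e_1e_2=e_3$, $e_2e_1=-e_3$; $\mathrm{R}_{01}$: $e_1e_1=e_2$, $e_1e_3=e_2$, $e_3e_1=-e_2$; $\mathrm{R}_{02}^{\alpha}$: $e_1e_2=(1+\alpha)e_3$, $e_2e_1=(1-\alpha)e_3$; $\mathrm{R}_{03}$: $e_1e_1=e_1$, $e_1e_2=e_2$, $e_1e_3=e_3$, $e_3e_1=e_3$; $\mathrm{R}_{04}$: $e_1e_1=e_1$, $e_1e_2=e_2+e_3$, $e_1e_3=e_3$, $e_2e_1=-e_3$, $e_3e_1=e_3$; $\mathrm{R}_{05}$: $e_1e_1=e_1$, $e_1e_3=e_3$, $e_2e_1=e_2$, $e_3e_1=e_3$; $\mathrm{R}_{06}$: $e_1e_1=e_1$, $e_1e_2=e_2$, $e_1e_3=e_3$; $\mathrm{R}_{07}$: $e_1e_1=e_1$, $e_2e_1=e_2$, $e_3e_1=e_3$; $\mathrm{R}_{08}$: $e_1e_1=e_1$, $e_1e_3=e_3$, $e_2e_1=e_2$; $\mathrm{R}_{09}$: $e_1e_1=e_1$, $e_2e_1=e_2$, $e_2e_2=e_3$; $\mathrm{R}_{10}$: $e_1e_1=e_1$, $e_1e_2=e_2$, $e_1e_3=e_3$, $e_2e_2=e_3$, $e_3e_1=e_3$;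 $\mathrm{R}_{11}$: $e_1e_1=e_1$, $e_1e_3=e_3$, $e_2e_2=e_2$, $e_3e_2=e_3$; $\mathrm{R}_{12}$: $e_1e_1=e_1$, $e_2e_1=e_2$; $\mathrm{R}_{13}$: $e_1e_1=e_1$, $e_1e_2=e_3$, $e_2e_1=e_2-e_3$; $\mathrm{R}_{14}$: $e_1e_1=e_1$, $e_1e_2=e_2$; $\mathrm{R}_{15}$: $e_1e_1=e_1$, $e_1e_3=e_3$, $e_2e_2=e_2$; $\mathrm{R}_{16}$: $e_1e_1=e_1$, $e_2e_2=e_2$, $e_3e_1=e_3$. *)

theory Defs
  imports "HOL-Analysis.Cartesian_Space"
begin

locale nonassoc_algebra = vector_space scl
  for scl :: "'k::field \<Rightarrow> 'a::ab_group_add \<Rightarrow> 'a" +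
  fixes mult :: "'a \<Rightarrow> 'a \<Rightarrow> 'a"
  assumes linear_mult_left: "Vector_Spaces.linear scl scl (\<lambda>x. mult x y)"
    and linear_mult_right: "Vector_Spaces.linear scl scl (\<lambda>y. mult x y)"

definition associator :: "('a::ab_group_add \<Rightarrow> 'a \<Rightarrow> 'a) \<Rightarrow> 'a \<Rightarrow> 'a \<Rightarrow> 'a \<Rightarrow> 'a" where
  "associator mult x y z = mult (mult x y) z - mult x (mult y z)"

definition right_alternative :: "('a::ab_group_add \<Rightarrow> 'a \<Rightarrow> 'a) \<Rightarrow> bool" where
  "right_alternative mult \<longleftrightarrow>
     (\<forall>x y z. associator mult x y z = - associator mult x z y)"

locale minus_one_one_algebra = nonassoc_algebra +
  assumes right_alternative: "right_alternative mult"
    and cyclic_associator: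
      "associator mult x y z + associator mult y z x + associator mult z x y = 0"

definition algebra_isomorphic ::
  "('k::field \<Rightarrow> 'a::ab_group_add \<Rightarrow> 'a) \<Rightarrow> ('a \<Rightarrow> 'a \<Rightarrow> 'a) \<Rightarrow>
   ('k \<Rightarrow> 'b::ab_group_add \<Rightarrow> 'b) \<Rightarrow> ('b \<Rightarrow> 'b \<Rightarrow> 'b) \<Rightarrow> bool" where
  "algebra_isomorphic scl mult scl' mult' \<longleftrightarrow>
     (\<exists>f. Vector_Spaces.linear scl scl' f \<and> bij f \<and>
          (\<forall>x y. f (mult x y) = mult' (f x) (f y)))"

text \<open>
  The concrete algebras live on \<open>complex^3\<close> with its standard basis. In the index type \<open>3\<close>
  the numeral \<open>3\<close> denotes the same element as \<open>0\<close>, so \<open>1\<close>, \<open>2\<close>, \<open>3\<close> are its three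
  distinct elements.
\<close>

abbreviation e :: "3 \<Rightarrow> complex^3" where
  "e i \<equiv> axis i 1"

type_synonym product_table = "((3 \<times> 3) \<times> (complex^3)) list"

text \<open>
  The entry \<open>((i, j), v)\<close> of a table stands for the basis product \<open>e\<^sub>i e\<^sub>j = v\<close>;
  basis products without an entry are zero.
\<close>

definition basis_product :: "product_table \<Rightarrow> 3 \<Rightarrow> 3 \<Rightarrow> complex^3" where
  "basis_product t i j = (case map_of t (i, j) of None \<Rightarrow> 0 | Some v \<Rightarrow> v)"

definition table_mult :: "product_table \<Rightarrow> complex^3 \<Rightarrow> complex^3 \<Rightarrow> complex^3" where
  "table_mult t x y = (\<Sum>i\<in>UNIV. \<Sum>j\<in>UNIV. (x $ i * y $ j) *s basis_product t i j)"

definition comm_table_mult :: "product_table \<Rightarrow> complex^3 \<Rightarrow> complex^3 \<Rightarrow> complex^3" where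
  "comm_table_mult t = table_mult (t @ map (\<lambda>((i, j), v). ((j, i), v)) t)"

definition A01 :: "complex^3 \<Rightarrow> complex^3 \<Rightarrow> complex^3" where
  "A01 = comm_table_mult [((1, 1), e 1), ((2, 2), e 2)]"

definition A02 :: "complex^3 \<Rightarrow> complex^3 \<Rightarrow> complex^3" where
  "A02 = comm_table_mult [((1, 1), e 1), ((1, 2), e 2)]"

definition A03 :: "complex^3 \<Rightarrow> complex^3 \<Rightarrow> complex^3" where
  "A03 = comm_table_mult [((1, 1), e 1)]"

definition A04 :: "complex^3 \<Rightarrow> complex^3 \<Rightarrow> complex^3" where
  "A04 = comm_table_mult [((1, 1), e 2)]"

definition A05 :: "complex^3 \<Rightarrow> complex^3 \<Rightarrow> complex^3" where
  "A05 = comm_table_mult [((1, 2), e 3)]"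

definition A06 :: "complex^3 \<Rightarrow> complex^3 \<Rightarrow> complex^3" where
  "A06 = comm_table_mult [((1, 1), e 2), ((1, 2), e 3)]"

definition A07 :: "complex^3 \<Rightarrow> complex^3 \<Rightarrow> complex^3" where
  "A07 = comm_table_mult [((1, 1), e 1), ((2, 2), e 2), ((3, 3), e 3)]"

definition A08 :: "complex^3 \<Rightarrow> complex^3 \<Rightarrow> complex^3" where
  "A08 = comm_table_mult [((1, 1), e 1), ((2, 2), e 2), ((2, 3), e 3)]"

definition A09 :: "complex^3 \<Rightarrow> complex^3 \<Rightarrow> complex^3" where
  "A09 = comm_table_mult [((1, 1), e 1), ((1, 2), e 2), ((1, 3), e 3)]"

definition A10 :: "complex^3 \<Rightarrow> complex^3 \<Rightarrow> complex^3" where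
  "A10 = comm_table_mult [((1, 1), e 1), ((1, 2), e 2), ((1, 3), e 3), ((2, 2), e 3)]"

definition A11 :: "complex^3 \<Rightarrow> complex^3 \<Rightarrow> complex^3" where
  "A11 = comm_table_mult [((1, 1), e 1), ((2, 2), e 3)]"

definition R00 :: "complex^3 \<Rightarrow> complex^3 \<Rightarrow> complex^3" where
  "R00 = table_mult [((1, 2), e 3), ((2, 1), - e 3)]"

definition R01 :: "complex^3 \<Rightarrow> complex^3 \<Rightarrow> complex^3" where
  "R01 = table_mult [((1, 1), e 2), ((1, 3), e 2), ((3, 1), - e 2)]"

definition R02 :: "complex \<Rightarrow> complex^3 \<Rightarrow> complex^3 \<Rightarrow> complex^3" where
  "R02 \<alpha> = table_mult [((1, 2), (1 + \<alpha>) *s e 3), ((2, 1), (1 - \<alpha>) *s e 3)]"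

definition R03 :: "complex^3 \<Rightarrow> complex^3 \<Rightarrow> complex^3" where
  "R03 = table_mult [((1, 1), e 1), ((1, 2), e 2), ((1, 3), e 3), ((3, 1), e 3)]"

definition R04 :: "complex^3 \<Rightarrow> complex^3 \<Rightarrow> complex^3" where
  "R04 = table_mult [((1, 1), e 1), ((1, 2), e 2 + e 3), ((1, 3), e 3), ((2, 1), - e 3), ((3, 1), e 3)]"

definition R05 :: "complex^3 \<Rightarrow> complex^3 \<Rightarrow> complex^3" where
  "R05 = table_mult [((1, 1), e 1), ((1, 3), e 3), ((2, 1), e 2), ((3, 1), e 3)]"

definition R06 :: "complex^3 \<Rightarrow> complex^3 \<Rightarrow> complex^3" where
  "R06 = table_mult [((1, 1), e 1), ((1, 2), e 2), ((1, 3), e 3)]"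

definition R07 :: "complex^3 \<Rightarrow> complex^3 \<Rightarrow> complex^3" where
  "R07 = table_mult [((1, 1), e 1), ((2, 1), e 2), ((3, 1), e 3)]"

definition R08 :: "complex^3 \<Rightarrow> complex^3 \<Rightarrow> complex^3" where
  "R08 = table_mult [((1, 1), e 1), ((1, 3), e 3), ((2, 1), e 2)]"

definition R09 :: "complex^3 \<Rightarrow> complex^3 \<Rightarrow> complex^3" where
  "R09 = table_mult [((1, 1), e 1), ((2, 1), e 2), ((2, 2), e 3)]"

definition R10 :: "complex^3 \<Rightarrow> complex^3 \<Rightarrow> complex^3" where
  "R10 = table_mult [((1, 1), e 1), ((1, 2), e 2), ((1, 3), e 3), ((2, 2), e 3), ((3, 1), e 3)]"

definition R11 :: "complex^3 \<Rightarrow> complex^3 \<Rightarrow> complex^3" where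
  "R11 = table_mult [((1, 1), e 1), ((1, 3), e 3), ((2, 2), e 2), ((3, 2), e 3)]"

definition R12 :: "complex^3 \<Rightarrow> complex^3 \<Rightarrow> complex^3" where
  "R12 = table_mult [((1, 1), e 1), ((2, 1), e 2)]"

definition R13 :: "complex^3 \<Rightarrow> complex^3 \<Rightarrow> complex^3" where
  "R13 = table_mult [((1, 1), e 1), ((1, 2), e 3), ((2, 1), e 2 - e 3)]"

definition R14 :: "complex^3 \<Rightarrow> complex^3 \<Rightarrow> complex^3" where
  "R14 = table_mult [((1, 1), e 1), ((1, 2), e 2)]"

definition R15 :: "complex^3 \<Rightarrow> complex^3 \<Rightarrow> complex^3" where
  "R15 = table_mult [((1, 1), e 1), ((1, 3), e 3), ((2, 2), e 2)]"

definition R16 :: "complex^3 \<Rightarrow> complex^3 \<Rightarrow> complex^3" where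
  "R16 = table_mult [((1, 1), e 1), ((2, 2), e 2), ((3, 1), e 3)]"

definition listed_algebras :: "(complex^3 \<Rightarrow> complex^3 \<Rightarrow> complex^3) set" where
  "listed_algebras =
     {A01, A02, A03, A04, A05, A06, A07, A08, A09, A10, A11, R00, R01}
     \<union> {R02 \<alpha> | \<alpha>. \<alpha> \<noteq> 0}
     \<union> {R03, R04, R05, R06, R07, R08, R09, R10, R11, R12, R13, R14, R15, R16}"

end

theory Submission
  imports Defs "HOL-Computational_Algebra.Fundamental_Theorem_Algebra"
begin

text \<open>
  The key dichotomy: by right alternativity the powers of an element \<open>x\<close> satisfy
  \<open>R\<^bsub>x^n\<^esub> = R\<^sub>x^n\<close>, and in dimension 3 this yields a nonzero idempotent as soon as some \<open>x\<^sup>4\<close> is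
  nonzero.

  For an idempotent \<open>u\<close>, with \<open>L\<close> and \<open>R\<close> its left and right multiplications, the relations
  \<open>R\<^sup>2 = R\<close> and \<open>L - L\<^sup>2 = L R - R L\<close> give a Peirce decomposition
  \<open>A\<^sub>1\<^sub>1 + A\<^sub>0\<^sub>0 + A\<^sub>1\<^sub>0 + A\<^sub>0\<^sub>1\<close> in which \<open>L\<close> is only triangular on the last two components. If there are two
  orthogonal idempotents, they leave room for one more basis vector, which may be taken in a Peirce
  component. Otherwise \<open>A\<^sub>0\<^sub>0\<close> is nil, \<open>A\<^sub>1\<^sub>1\<close> is local, and the Peirce types of the two
  vectors completing \<open>u\<close> to a basis leave at most two structure constants free.

  If all fourth powers vanish and the algebra is not generated by one element, then its square is a
  line annihilated by everything, so the multiplication is a bilinear form on a plane; these are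
  classified by the rank of the symmetric part and the vanishing of the alternating part.
\<close>

section \<open>Bilinear identities of the algebra\<close>

locale dim3_algebra = minus_one_one_algebra scl mult
  for scl :: "complex \<Rightarrow> 'a::ab_group_add \<Rightarrow> 'a" (infixr "\<odot>" 75)
    and mult :: "'a \<Rightarrow> 'a \<Rightarrow> 'a" (infixl "\<cdot>" 70) +
  assumes dim3: "dim UNIV = 3"
begin

lemma mult_linear [simp]:
  "(x + y) \<cdot> z = x \<cdot> z + y \<cdot> z" "z \<cdot> (x + y) = z \<cdot> x + z \<cdot> y"
  "(x - y) \<cdot> z = x \<cdot> z - y \<cdot> z" "z \<cdot> (x - y) = z \<cdot> x - z \<cdot> y"
  "(- x) \<cdot> z = - (x \<cdot> z)" "z \<cdot> (- x) = - (z \<cdot> x)"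
  "(k \<odot> x) \<cdot> z = k \<odot> (x \<cdot> z)" "z \<cdot> (k \<odot> x) = k \<odot> (z \<cdot> x)"
  "0 \<cdot> z = 0" "z \<cdot> 0 = 0"
proof -
  interpret l: Vector_Spaces.linear scl scl "\<lambda>x. x \<cdot> z" by (rule linear_mult_left)
  interpret r: Vector_Spaces.linear scl scl "\<lambda>x. z \<cdot> x" by (rule linear_mult_right)
  show
    "(x + y) \<cdot> z = x \<cdot> z + y \<cdot> z" "z \<cdot> (x + y) = z \<cdot> x + z \<cdot> y"
    "(x - y) \<cdot> z = x \<cdot> z - y \<cdot> z" "z \<cdot> (x - y) = z \<cdot> x - z \<cdot> y"
    "(- x) \<cdot> z = - (x \<cdot> z)" "z \<cdot> (- x) = - (z \<cdot> x)"
    "(k \<odot> x) \<cdot> z = k \<odot> (x \<cdot> z)" "z \<cdot> (k \<odot> x) = k \<odot> (z \<cdot> x)"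
    "0 \<cdot> z = 0" "z \<cdot> 0 = 0"
    by (fact l.add r.add l.diff r.diff l.neg r.neg l.scale r.scale l.zero r.zero)+
qed

lemma right_alt: "x \<cdot> (y \<cdot> z) + x \<cdot> (z \<cdot> y) = (x \<cdot> y) \<cdot> z + (x \<cdot> z) \<cdot> y"
  using right_alternative unfolding right_alternative_def associator_def
  by (metis (no_types, lifting) add_diff_eq diff_eq_eq minus_diff_eq add.commute diff_diff_eq2)

lemma cyclic:
  "(x \<cdot> y) \<cdot> z + (y \<cdot> z) \<cdot> x + (z \<cdot> x) \<cdot> y = x \<cdot> (y \<cdot> z) + y \<cdot> (z \<cdot> x) + z \<cdot> (x \<cdot> y)"
  using cyclic_associator[of x y z] unfolding associator_def by (simp add: algebra_simps)

text \<open>Linearised identities evaluated at equal arguments come out doubled; characteristic 0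
  removes the factor 2.\<close>

lemma double_cancel: "x + x = y + y \<Longrightarrow> x = y" for x y :: 'a
proof -
  assume "x + x = y + y"
  then have "2 \<odot> x = 2 \<odot> y"
    using scale_left_distrib[of 1 1 x] scale_left_distrib[of 1 1 y] by simp
  then show ?thesis by simp
qed

lemma right_alt_square: "(x \<cdot> y) \<cdot> y = x \<cdot> (y \<cdot> y)"
  using right_alt[of x y y] by (metis double_cancel)

section \<open>Bases of a three-dimensional space\<close>

definition indep3 :: "'a \<Rightarrow> 'a \<Rightarrow> 'a \<Rightarrow> bool" where
  "indep3 u v w \<longleftrightarrow>
     (\<forall>a b c. a \<odot> u + b \<odot> v + c \<odot> w = 0 \<longrightarrow> a = 0 \<and> b = 0 \<and> c = 0)"

lemma indep3_distinct:
  assumes "indep3 u v w"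
  shows "u \<noteq> v" "u \<noteq> w" "v \<noteq> w"
proof -
  have *: "a \<odot> u + b \<odot> v + c \<odot> w = 0 \<longrightarrow> a = 0 \<and> b = 0 \<and> c = 0" for a b c
    using assms by (simp add: indep3_def)
  show "u \<noteq> v" using *[of 1 "-1" 0] by auto
  show "u \<noteq> w" using *[of 1 0 "-1"] by auto
  show "v \<noteq> w" using *[of 0 1 "-1"] by auto
qed

text \<open>\<open>indep3\<close> speaks of a triple, \<open>independent\<close> of a set in which
  repeated vectors collapse; hence the distinctness hypotheses.\<close>

lemma independent_iff_indep3:
  assumes "u \<noteq> v" "u \<noteq> w" "v \<noteq> w"
  shows "independent {u, v, w} \<longleftrightarrow> indep3 u v w"
proof
  assume i: "independent {u, v, w}"
  show "indep3 u v w" unfolding indep3_def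
  proof (intro allI impI)
    fix a b c assume "a \<odot> u + b \<odot> v + c \<odot> w = 0"
    then have s: "(\<Sum>x\<in>{u,v,w}. (if x = u then a else if x = v then b else c) \<odot> x) = 0"
      using assms by (simp add: add.assoc)
    show "a = 0 \<and> b = 0 \<and> c = 0"
      using independentD[OF i _ order_refl s, of u] independentD[OF i _ order_refl s, of v]
        independentD[OF i _ order_refl s, of w] assms by simp
  qed
next
  assume i: "indep3 u v w"
  show "independent {u, v, w}"
  proof
    assume "dependent {u, v, w}"
    then obtain k where k: "\<exists>x\<in>{u, v, w}. k x \<noteq> 0" "(\<Sum>x\<in>{u, v, w}. k x \<odot> x) = 0"
      using dependent_finite[of "{u, v, w}"] by auto
    have "k u \<odot> u + k v \<odot> v + k w \<odot> w = 0"
      using k(2) assms by (simp add: add.assoc)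
    then have "k u = 0 \<and> k v = 0 \<and> k w = 0"
      using i unfolding indep3_def by blast
    with k(1) show False by auto
  qed
qed

text \<open>Both \<open>dim\<close> and \<open>card\<close> take the value 0 by default, so the
  value 3 forces a basis to exist and to be finite.\<close>

lemma finite_dimensional:
  obtains B where "finite_dimensional_vector_space scl B"
proof -
  obtain b where b: "independent b" "span b = span UNIV"
    using dim3 by (metis dim_def zero_neq_numeral)
  then have "card b = 3" using dim_eq_card dim3 by metis
  then have "finite b" by (metis card.infinite zero_neq_numeral)
  with b have "finite_dimensional_vector_space scl b"
    by unfold_locales auto
  then show thesis by (rule that)
qed

lemma indep3_span:
  assumes "indep3 u v w"
  shows "\<exists>a b c. x = a \<odot> u + b \<odot> v + c \<odot> w"
proof -
  obtain B where "finite_dimensional_vector_space scl B" by (rule finite_dimensional)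
  then interpret fd: finite_dimensional_vector_space scl B .
  note d = indep3_distinct[OF assms]
  have "independent {u, v, w}" using assms independent_iff_indep3[OF d] by simp
  moreover have "card {u, v, w} = 3" using d by simp
  ultimately have "UNIV \<subseteq> span {u, v, w}"
    using fd.card_ge_dim_independent[of "{u, v, w}" UNIV] dim3 by simp
  then have "x \<in> span {u, v, w}" by blast
  then show ?thesis
    by (auto simp: span_insert span_empty) (metis add.commute add.left_commute diff_add_cancel diff_eq_eq)
qed

text \<open>A maximal independent subset of \<open>T\<close> containing \<open>x\<close> does it.
  With \<open>T\<close> made of Peirce vectors this yields bases adapted to an idempotent.\<close>

lemma span_contains_indep3:
  assumes "x \<in> T" "x \<noteq> 0" "span T = UNIV"
  obtains y z where "y \<in> T" "z \<in> T" "indep3 x y z"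
proof -
  obtain B where "finite_dimensional_vector_space scl B" by (rule finite_dimensional)
  then interpret fd: finite_dimensional_vector_space scl B .
  obtain C where C: "{x} \<subseteq> C" "C \<subseteq> T" "independent C" "T \<subseteq> span C"
    using maximal_independent_subset_extend[of "{x}" T] assms by auto
  have "UNIV \<subseteq> span C" using C(4) assms(3) by (metis span_minimal subspace_span)
  then have "card C = 3" using basis_card_eq_dim[of C UNIV] C(3) dim3 by simp
  then obtain p q r where pqr: "C = {p, q, r}" "p \<noteq> q" "p \<noteq> r" "q \<noteq> r"
    by (auto simp: card_3_iff)
  with C(1) consider "x = p" | "x = q" | "x = r" by auto
  then obtain y z where yz: "C = {x, y, z}" "x \<noteq> y" "x \<noteq> z" "y \<noteq> z"
    using pqr by cases (metis insert_commute)+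
  then have "indep3 x y z" using independent_iff_indep3 C(3) by simp
  with yz C(2) show thesis using that by auto
qed

section \<open>Recognising an algebra by its multiplication table\<close>

definition classified :: bool where
  "classified \<longleftrightarrow> (\<exists>B \<in> listed_algebras. algebra_isomorphic scl mult vector_scalar_mult B)"

text \<open>Coordinates in a basis with the prescribed nine products are an isomorphism. Every case
  of the classification ends here; the final \<open>else\<close> branch is the index 3.\<close>

lemma classifiedI:
  assumes B: "B \<in> listed_algebras" "B = table_mult t"
    and ind: "indep3 u v w"
    and products: "\<forall>i j. mult (if i = 1 then u else if i = 2 then v else w)
        (if j = 1 then u else if j = 2 then v else w) =
      (basis_product t i j $ 1) \<odot> u + (basis_product t i j $ 2) \<odot> v + (basis_product t i j $ 3) \<odot> w"
  shows classified
proof -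
  define b :: "3 \<Rightarrow> 'a" where "b i = (if i = 1 then u else if i = 2 then v else w)" for i
  have b: "b 1 = u" "b 2 = v" "b 3 = w" by (simp_all add: b_def)
  have bb: "b i \<cdot> b j = (\<Sum>k\<in>UNIV. (basis_product t i j $ k) \<odot> b k)" for i j
    using products[rule_format, of i j] by (simp add: b_def sum_3)
  \<comment> \<open>The linear extension of e_i to \<open>b i\<close>; the required isomorphism is
    its inverse.\<close>
  define g :: "complex^3 \<Rightarrow> 'a" where "g x = (\<Sum>k\<in>UNIV. (x $ k) \<odot> b k)" for x
  have g_add: "g (x + y) = g x + g y" for x y
    by (simp add: g_def scale_left_distrib sum.distrib)
  have g_scale: "g (k *s x) = k \<odot> g x" for k x
    by (simp add: g_def scale_sum_right)
  have g_sum: "g (sum f UNIV) = (\<Sum>i\<in>UNIV. g (f i))" for f :: "3 \<Rightarrow> complex^3"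
    by (simp add: sum_3 g_add)
  have g_mult: "g (table_mult t x y) = g x \<cdot> g y" for x y
  proof -
    have "g (table_mult t x y) = (\<Sum>i\<in>UNIV. \<Sum>j\<in>UNIV. (x $ i * y $ j) \<odot> g (basis_product t i j))"
      by (simp add: table_mult_def g_sum g_scale)
    also have "\<dots> = (\<Sum>i\<in>UNIV. \<Sum>j\<in>UNIV. (x $ i * y $ j) \<odot> (b i \<cdot> b j))"
      by (simp add: bb g_def)
    also have "\<dots> = g x \<cdot> g y"
      by (simp add: g_def sum_3 scale_right_distrib algebra_simps)
    finally show ?thesis .
  qed
  have g3: "g x = x $ 1 \<odot> u + x $ 2 \<odot> v + x $ 3 \<odot> w" for x
    by (simp add: g_def sum_3 b)
  have "inj g"
  proof (rule injI)
    fix x y assume "g x = g y"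
    then have "g (x + (-1) *s y) = 0" by (simp only: g_add g_scale) simp
    then have "x $ 1 - y $ 1 = 0 \<and> x $ 2 - y $ 2 = 0 \<and> x $ 3 - y $ 3 = 0"
      using ind unfolding g3 indep3_def by fastforce
    then show "x = y" by (simp add: vec_eq_iff forall_3)
  qed
  moreover have "surj g"
  proof (rule surjI)
    fix x
    obtain p where p: "x = fst p \<odot> u + fst (snd p) \<odot> v + snd (snd p) \<odot> w"
      using indep3_span[OF ind, of x] by (metis fst_conv snd_conv)
    show "g (SOME y. g y = x) = x"
      by (rule someI[of _ "vector [fst p, fst (snd p), snd (snd p)]"]) (simp add: g3 p)
  qed
  ultimately have "bij g" by (rule bijI)
  have "algebra_isomorphic scl mult vector_scalar_mult (table_mult t)"
    unfolding algebra_isomorphic_def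
  proof (intro exI[of _ "inv g"] conjI allI)
    have g_inv: "g (inv g x) = x" for x using \<open>bij g\<close> by (simp add: bij_is_surj surj_f_inv_f)
    have inv_eq: "inv g x = y \<longleftrightarrow> x = g y" for x y using \<open>bij g\<close> g_inv
      by (metis bij_inv_eq_iff)
    show "bij (inv g)" using \<open>bij g\<close> by (rule bij_imp_bij_inv)
    show "Vector_Spaces.linear scl vector_scalar_mult (inv g)"
      by (rule Vector_Spaces.linear_iff[THEN iffD2])
        (auto simp: inv_eq g_add g_scale g_inv vec.vector_space_axioms vector_space_axioms)
    show "inv g (x \<cdot> y) = table_mult t (inv g x) (inv g y)" for x y
      by (simp add: inv_eq g_mult g_inv)
  qed
  with B show ?thesis unfolding classified_def by blast
qed

lemmas table_simps = forall_3 basis_product_def axis_def listed_algebras_def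

subsection \<open>Powers and idempotents\<close>

text \<open>Since x x^2 = x^2 x, right alternativity for x and x^2 reads 2 R_{x^3} = R_x R_{x^2} +
  R_{x^2} R_x, and R_{x^2} = R_x^2.\<close>

lemma right_mult_cube: "y \<cdot> (x \<cdot> x \<cdot> x) = y \<cdot> x \<cdot> x \<cdot> x"
proof (rule double_cancel)
  have "y \<cdot> (x \<cdot> (x \<cdot> x)) + y \<cdot> (x \<cdot> x \<cdot> x) = y \<cdot> x \<cdot> (x \<cdot> x) + y \<cdot> (x \<cdot> x) \<cdot> x"
    by (rule right_alt)
  then show "y \<cdot> (x \<cdot> x \<cdot> x) + y \<cdot> (x \<cdot> x \<cdot> x) = y \<cdot> x \<cdot> x \<cdot> x + y \<cdot> x \<cdot> x \<cdot> x"
    by (simp add: right_alt_square[symmetric])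
qed

lemma right_mult_fourth: "y \<cdot> (x \<cdot> x \<cdot> x \<cdot> x) = y \<cdot> x \<cdot> x \<cdot> x \<cdot> x"
proof (rule double_cancel)
  have "y \<cdot> (x \<cdot> (x \<cdot> x \<cdot> x)) + y \<cdot> (x \<cdot> x \<cdot> x \<cdot> x) = y \<cdot> x \<cdot> (x \<cdot> x \<cdot> x) + y \<cdot> (x \<cdot> x \<cdot> x) \<cdot> x"
    by (rule right_alt)
  then show "y \<cdot> (x \<cdot> x \<cdot> x \<cdot> x) + y \<cdot> (x \<cdot> x \<cdot> x \<cdot> x) = y \<cdot> x \<cdot> x \<cdot> x \<cdot> x + y \<cdot> x \<cdot> x \<cdot> x \<cdot> x"
    by (simp add: right_mult_cube)
qed

lemma powers_dependent:
  obtains a b c d where "a \<noteq> 0 \<or> b \<noteq> 0 \<or> c \<noteq> 0 \<or> d \<noteq> 0"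
    "a \<odot> x + b \<odot> (x \<cdot> x) + c \<odot> (x \<cdot> x \<cdot> x) + d \<odot> (x \<cdot> x \<cdot> x \<cdot> x) = 0"
proof (cases "indep3 x (x \<cdot> x) (x \<cdot> x \<cdot> x)")
  case True
  then obtain a b c where
    "x \<cdot> x \<cdot> x \<cdot> x = a \<odot> x + b \<odot> (x \<cdot> x) + c \<odot> (x \<cdot> x \<cdot> x)"
    using indep3_span by blast
  then show thesis by (intro that[of a b c "-1"]) simp_all
next
  case False
  then obtain a b c where "a \<noteq> 0 \<or> b \<noteq> 0 \<or> c \<noteq> 0"
    "a \<odot> x + b \<odot> (x \<cdot> x) + c \<odot> (x \<cdot> x \<cdot> x) = 0"
    unfolding indep3_def by blast
  then show thesis by (intro that[of a b c 0]) simp_all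
qed

text \<open>
  The lowest term of a linear relation between the powers of \<open>x\<close> gives
  \<open>x\<^sup>4 s = x\<^sup>4\<close> with \<open>s\<close> a combination of \<open>x, x\<^sup>2, x\<^sup>3\<close>; then \<open>s\<^sup>4\<close> is the idempotent.
\<close>
lemma idempotent_of_not_nil:
  assumes nz: "x \<cdot> x \<cdot> x \<cdot> x \<noteq> 0"
  obtains f where "f \<noteq> 0" "f \<cdot> f = f"
    "\<And>S. x \<in> S \<Longrightarrow> (\<And>y z. y \<in> S \<Longrightarrow> z \<in> S \<Longrightarrow> y + z \<in> S) \<Longrightarrow> (\<And>k y. y \<in> S \<Longrightarrow> k \<odot> y \<in> S) \<Longrightarrow>
        (\<And>y. y \<in> S \<Longrightarrow> y \<cdot> x \<in> S) \<Longrightarrow> f \<in> S"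
proof -
  define x4 where "x4 = x \<cdot> x \<cdot> x \<cdot> x"
  obtain a b c d where ne: "a \<noteq> 0 \<or> b \<noteq> 0 \<or> c \<noteq> 0 \<or> d \<noteq> 0" and
    rel: "a \<odot> x + b \<odot> (x \<cdot> x) + c \<odot> (x \<cdot> x \<cdot> x) + d \<odot> x4 = 0"
    using powers_dependent x4_def by metis
  have relR: "a \<odot> (x \<cdot> x) + b \<odot> (x \<cdot> x \<cdot> x) + c \<odot> x4 + d \<odot> (x4 \<cdot> x) = 0"
    using arg_cong[OF rel, of "\<lambda>y. y \<cdot> x"] by (simp add: x4_def)
  have relR2: "a \<odot> (x \<cdot> x \<cdot> x) + b \<odot> x4 + c \<odot> (x4 \<cdot> x) + d \<odot> (x4 \<cdot> x \<cdot> x) = 0"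
    using arg_cong[OF relR, of "\<lambda>y. y \<cdot> x"] by (simp add: x4_def)
  have relR3: "a \<odot> x4 + b \<odot> (x4 \<cdot> x) + c \<odot> (x4 \<cdot> x \<cdot> x) + d \<odot> (x4 \<cdot> x \<cdot> x \<cdot> x) = 0"
    using arg_cong[OF relR2, of "\<lambda>y. y \<cdot> x"] by (simp add: x4_def)
  have solve: "y = (- p / k) \<odot> z1 + (- q / k) \<odot> z2 + (- r / k) \<odot> z3"
    if "k \<odot> y + p \<odot> z1 + q \<odot> z2 + r \<odot> z3 = 0" "k \<noteq> 0" for k p q r y z1 z2 z3
  proof -
    have "k \<odot> y = - (p \<odot> z1 + q \<odot> z2 + r \<odot> z3)"
      using that(1) unfolding eq_neg_iff_add_eq_0 by (simp only: add.assoc)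
    then have "y = (1 / k) \<odot> - (p \<odot> z1 + q \<odot> z2 + r \<odot> z3)"
      using that(2) by (metis divide_self scale_one scale_scale times_divide_eq_left mult_1)
    then show ?thesis by (simp add: scale_right_diff_distrib)
  qed
  have "\<exists>p q r. x4 = p \<odot> (x4 \<cdot> x) + q \<odot> (x4 \<cdot> x \<cdot> x) + r \<odot> (x4 \<cdot> x \<cdot> x \<cdot> x)"
  proof -
    \<comment> \<open>One of the shifted relations has its lowest nonzero term at x^4; dividing by
      its coefficient expresses x^4 through higher powers. If only d survives, x^4 itself
      vanishes.\<close>
    consider "a \<noteq> 0" | "a = 0" "b \<noteq> 0" | "a = 0" "b = 0" "c \<noteq> 0"
      | "a = 0" "b = 0" "c = 0" "d \<noteq> 0" using ne by blast
    then show ?thesis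
    proof cases
      case 1
      from solve[OF relR3 this] show ?thesis by blast
    next
      case 2
      then have "b \<odot> x4 + c \<odot> (x4 \<cdot> x) + d \<odot> (x4 \<cdot> x \<cdot> x) + 0 \<odot> (x4 \<cdot> x \<cdot> x \<cdot> x) = 0"
        using relR2 by simp
      from solve[OF this 2(2)] show ?thesis by blast
    next
      case 3
      then have "c \<odot> x4 + d \<odot> (x4 \<cdot> x) + 0 \<odot> (x4 \<cdot> x \<cdot> x) + 0 \<odot> (x4 \<cdot> x \<cdot> x \<cdot> x) = 0"
        using relR by simp
      from solve[OF this 3(3)] show ?thesis by blast
    next
      case 4
      with rel nz show ?thesis by (simp add: x4_def)
    qed
  qed
  then obtain p q r where
    pqr: "x4 = p \<odot> (x4 \<cdot> x) + q \<odot> (x4 \<cdot> x \<cdot> x) + r \<odot> (x4 \<cdot> x \<cdot> x \<cdot> x)" by blast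
  \<comment> \<open>\<open>P\<close> is the polynomial p + q R_x + r R_x^2 in R_x; it commutes with
    R_x, and R_s = \<open>P\<close> R_x.\<close>
  define P where "P y = p \<odot> y + q \<odot> (y \<cdot> x) + r \<odot> (y \<cdot> x \<cdot> x)" for y
  define s where "s = P x"
  have Px: "P y \<cdot> x = P (y \<cdot> x)" for y by (simp add: P_def)
  have right_s: "y \<cdot> s = P (y \<cdot> x)" for y
    by (simp add: s_def P_def right_alt_square[symmetric] right_mult_cube)
  have Ps: "P y \<cdot> s = P (y \<cdot> s)" for y by (simp add: right_s Px)
  have x4s: "x4 \<cdot> s = x4" using pqr by (simp add: right_s P_def)
  \<comment> \<open>This is s^4 written as \<open>P\<close>^4 applied to x^4, whence f s = f because
    x^4 s = x^4. As R_f = R_s^4, both f f = f and x^4 f = x^4 follow.\<close>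
  define f where "f = P (P (P (P x4)))"
  have f: "f = s \<cdot> s \<cdot> s \<cdot> s"
    by (simp add: right_s) (simp add: s_def f_def Px x4_def)
  have right_f: "y \<cdot> f = y \<cdot> s \<cdot> s \<cdot> s \<cdot> s" for y
    unfolding f by (rule right_mult_fourth)
  have "f \<cdot> s = f" by (simp add: f_def Ps x4s)
  then have "f \<cdot> f = f" by (simp add: right_f)
  moreover have "x4 \<cdot> f = x4" by (simp add: right_f x4s)
  then have "f \<noteq> 0" using nz x4_def by force
  \<comment> \<open>A polynomial in R_x applied to x stays in every subspace that contains x and is
    stable under R_x. This locates f inside a Peirce component, or inside the span of a nilpotent
    candidate and its square.\<close>
  moreover have "f \<in> S" if "x \<in> S" "\<And>y z. y \<in> S \<Longrightarrow> z \<in> S \<Longrightarrow> y + z \<in> S"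
    "\<And>k y. y \<in> S \<Longrightarrow> k \<odot> y \<in> S" "\<And>y. y \<in> S \<Longrightarrow> y \<cdot> x \<in> S" for S
  proof -
    have "P y \<in> S" if "y \<in> S" for y
      unfolding P_def using that \<open>\<And>y z. y \<in> S \<Longrightarrow> z \<in> S \<Longrightarrow> y + z \<in> S\<close>
        \<open>\<And>k y. y \<in> S \<Longrightarrow> k \<odot> y \<in> S\<close> \<open>\<And>y. y \<in> S \<Longrightarrow> y \<cdot> x \<in> S\<close> by presburger
    with that show ?thesis by (simp add: f_def x4_def)
  qed
  ultimately show thesis using that by blast
qed

subsection \<open>Peirce decomposition\<close>

definition P11 :: "'a \<Rightarrow> 'a \<Rightarrow> bool" where
  "P11 u x \<longleftrightarrow> u \<cdot> x = x \<and> x \<cdot> u = x"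

definition P00 :: "'a \<Rightarrow> 'a \<Rightarrow> bool" where
  "P00 u x \<longleftrightarrow> u \<cdot> x = 0 \<and> x \<cdot> u = 0"

text \<open>
  The operator \<open>L - L\<^sup>2\<close> may be nonzero: it maps \<open>A\<^sub>1\<^sub>0\<close> into \<open>A\<^sub>1\<^sub>1\<close> and \<open>A\<^sub>0\<^sub>1\<close> into \<open>A\<^sub>0\<^sub>0\<close>. This is why
  \<open>P10\<close> and \<open>P01\<close> do not require \<open>u \<cdot> x = x\<close> and \<open>u \<cdot> x = 0\<close>.
\<close>
definition P10 :: "'a \<Rightarrow> 'a \<Rightarrow> bool" where
  "P10 u x \<longleftrightarrow> x \<cdot> u = 0 \<and> P11 u (u \<cdot> x - x)"

definition P01 :: "'a \<Rightarrow> 'a \<Rightarrow> bool" where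
  "P01 u x \<longleftrightarrow> x \<cdot> u = x \<and> P00 u (u \<cdot> x)"

lemma idem_right: "u \<cdot> u = u \<Longrightarrow> x \<cdot> u \<cdot> u = x \<cdot> u"
  by (simp add: right_alt_square)

lemma idem_flexible: "u \<cdot> u = u \<Longrightarrow> u \<cdot> (u \<cdot> x) + u \<cdot> (x \<cdot> u) = u \<cdot> x + u \<cdot> x \<cdot> u"
  using right_alt[of u u x] by simp

text \<open>On the 1-eigenspace of R the Peirce relations become R L = L^2 and L^3 = L^2, so L^2
  projects it onto A_11.\<close>

lemma peirce_right_unit:
  assumes u: "u \<cdot> u = u" and a: "a \<cdot> u = a"
  shows "P11 u (u \<cdot> (u \<cdot> a))" "P01 u (a - u \<cdot> (u \<cdot> a))"
proof -
  have 1: "u \<cdot> a \<cdot> u = u \<cdot> (u \<cdot> a)" using idem_flexible[OF u, of a] a by simp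
  have 2: "u \<cdot> (u \<cdot> a) \<cdot> u = u \<cdot> (u \<cdot> a)" using idem_right[OF u, of "u \<cdot> a"] 1 by simp
  have 3: "u \<cdot> (u \<cdot> (u \<cdot> a)) = u \<cdot> (u \<cdot> a)"
    by (rule double_cancel) (use idem_flexible[OF u, of "u \<cdot> a"] in \<open>simp add: 1 2\<close>)
  show "P11 u (u \<cdot> (u \<cdot> a))" "P01 u (a - u \<cdot> (u \<cdot> a))"
    by (simp_all add: P11_def P01_def P00_def 1 2 3 a)
qed

text \<open>The Peirce relations survive replacing L and R by 1 - L and 1 - R, which turns this into
  the preceding lemma. The vector \<open>z\<close> is (1 - (1 - L)^2) b.\<close>

lemma peirce_right_zero:
  assumes u: "u \<cdot> u = u" and b: "b \<cdot> u = 0"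
  defines "z \<equiv> u \<cdot> b + u \<cdot> b - u \<cdot> (u \<cdot> b)"
  shows "P10 u z" "P00 u (b - z)"
proof -
  have 1: "u \<cdot> (u \<cdot> b) = u \<cdot> b + u \<cdot> b \<cdot> u" using idem_flexible[OF u, of b] b by simp
  have 2: "u \<cdot> b \<cdot> u \<cdot> u = u \<cdot> b \<cdot> u" using idem_right[OF u] .
  have 3: "u \<cdot> (u \<cdot> b \<cdot> u) = u \<cdot> b \<cdot> u"
    by (rule double_cancel) (use idem_flexible[OF u, of "u \<cdot> b"] in \<open>simp add: 1 2 add.assoc add.left_commute\<close>)
  show "P10 u z" "P00 u (b - z)"
    by (simp_all add: z_def P11_def P10_def P00_def 1 2 3 b)
qed

definition peirce :: "'a \<Rightarrow> 'a \<Rightarrow> bool" where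
  "peirce u x \<longleftrightarrow> P11 u x \<or> P00 u x \<or> P10 u x \<or> P01 u x"

text \<open>The R-eigenvectors x u and x - x u add up to x, and the two preceding lemmas split each
  of them. Carrying an invariant subspace \<open>S\<close> along allows A_00 of one idempotent to be
  decomposed under another.\<close>

lemma peirce_span:
  assumes u: "u \<cdot> u = u" and S: "subspace S" "\<And>x. x \<in> S \<Longrightarrow> u \<cdot> x \<in> S" "\<And>x. x \<in> S \<Longrightarrow> x \<cdot> u \<in> S"
    and x: "x \<in> S"
  shows "x \<in> span (Collect (peirce u) \<inter> S)"
proof -
  let ?a = "x \<cdot> u" let ?b = "x - x \<cdot> u"
  let ?z = "u \<cdot> ?b + u \<cdot> ?b - u \<cdot> (u \<cdot> ?b)"
  have r: "x \<cdot> u \<cdot> u = x \<cdot> u" by (rule idem_right[OF u])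
  then have b: "?b \<cdot> u = 0" by simp
  have "peirce u (u \<cdot> (u \<cdot> ?a))" "peirce u (?a - u \<cdot> (u \<cdot> ?a))" "peirce u ?z" "peirce u (?b - ?z)"
    using peirce_right_unit[OF u r] peirce_right_zero[OF u b]
    unfolding peirce_def by blast+
  moreover have "u \<cdot> (u \<cdot> ?a) \<in> S" "?a - u \<cdot> (u \<cdot> ?a) \<in> S" "?z \<in> S" "?b - ?z \<in> S"
    by (intro subspace_add subspace_diff S x)+
  ultimately have "(u \<cdot> (u \<cdot> ?a) + (?a - u \<cdot> (u \<cdot> ?a))) + (?z + (?b - ?z))
      \<in> span (Collect (peirce u) \<inter> S)"
    by (intro span_add span_base) auto
  moreover have "(u \<cdot> (u \<cdot> ?a) + (?a - u \<cdot> (u \<cdot> ?a))) + (?z + (?b - ?z)) = x"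
    by (simp add: algebra_simps)
  ultimately show ?thesis by simp
qed

lemma peirce_basis:
  assumes "u \<cdot> u = u" "u \<noteq> 0"
  obtains x y where "peirce u x" "peirce u y" "indep3 u x y"
proof -
  have "span (Collect (peirce u)) = UNIV" using peirce_span[OF assms(1), of UNIV] by auto
  moreover have "peirce u u" using assms(1) by (simp add: peirce_def P11_def)
  ultimately show thesis using span_contains_indep3[of u "Collect (peirce u)"] assms(2) that by auto
qed

text \<open>Right alternativity makes x y and y x eigenvectors of R for -1 and 2, but R is
  idempotent and has only the eigenvalues 0 and 1.\<close>

lemma P11_P00_zero:
  assumes "u \<cdot> u = u" "P11 u x" "P00 u y"
  shows "x \<cdot> y = 0" "y \<cdot> x = 0"
proof -
  have 1: "x \<cdot> y \<cdot> u = - (x \<cdot> y)" and 2: "y \<cdot> x \<cdot> u = y \<cdot> x + y \<cdot> x"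
    using right_alt[of x u y] right_alt[of y u x] assms by (simp_all add: P11_def P00_def algebra_simps add_eq_0_iff)
  have "x \<cdot> y = - (x \<cdot> y)" using idem_right[OF assms(1), of "x \<cdot> y"] 1 by simp
  then show "x \<cdot> y = 0" using double_cancel[of "x \<cdot> y" 0] by (simp add: eq_neg_iff_add_eq_0)
  show "y \<cdot> x = 0" using idem_right[OF assms(1), of "y \<cdot> x"] 2 double_cancel[of "y \<cdot> x" 0] by (simp add: 2)
qed

text \<open>Right alternativity determines (x y) u; the cyclic identity then determines u (x
  y).\<close>

lemma P11_mult:
  assumes "P11 u x" "P11 u y" shows "P11 u (x \<cdot> y)"
  using right_alt[of x u y] cyclic[of u x y] assms by (auto simp: P11_def)

lemma P00_mult:
  assumes "P00 u x" "P00 u y" shows "P00 u (x \<cdot> y)"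
  using right_alt[of x u y] cyclic[of u x y] assms by (auto simp: P00_def)

section \<open>Nilpotency and squares around a single idempotent\<close>

definition no_orthogonal_idempotents :: bool where
  "no_orthogonal_idempotents \<longleftrightarrow>
     (\<forall>g h. g \<cdot> g = g \<longrightarrow> h \<cdot> h = h \<longrightarrow> g \<cdot> h = 0 \<longrightarrow> h \<cdot> g = 0 \<longrightarrow> g = 0 \<or> h = 0)"

text \<open>As the image of R is the line of u, both u x - x and x x are multiples of u; the
  identity (y x) x = y (x x) with y = u and y = x kills them in turn.\<close>

lemma P10_one_dim:
  assumes u: "u \<cdot> u = u" "u \<noteq> 0" and x: "P10 u x"
    and one_dim: "\<And>z. z \<cdot> u = z \<Longrightarrow> \<exists>k. z = k \<odot> u"
  shows "u \<cdot> x = x" "x \<cdot> x = 0"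
proof -
  have xu: "x \<cdot> u = 0" using x by (simp add: P10_def)
  obtain k where "u \<cdot> x - x = k \<odot> u" 
    using x one_dim[of "u \<cdot> x - x"] unfolding P10_def P11_def by blast
  then have k: "u \<cdot> x = x + k \<odot> u" by (simp add: algebra_simps)
  have "x \<cdot> x \<cdot> u = x \<cdot> x" using right_alt[of x u x] by (simp add: k xu)
  then obtain d where d: "x \<cdot> x = d \<odot> u" using one_dim by blast
  have "k \<odot> x + (k * k) \<odot> u = 0"
    using right_alt_square[of u x] by (simp add: k d u scale_right_distrib)
  then have "(k \<odot> x + (k * k) \<odot> u) \<cdot> u = 0" by (simp only: mult_linear)
  then have "k = 0" by (simp add: xu u)
  then show ux: "u \<cdot> x = x" using k by simp
  have "d \<odot> x = 0" using right_alt_square[of x x] by (simp add: d ux xu)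
  then show "x \<cdot> x = 0" using d by auto
qed

text \<open>Otherwise a multiple y of x is a square root of u, and (u + y)/2, (u - y)/2 are nonzero
  orthogonal idempotents.\<close>

lemma unital_square_zero:
  assumes u: "u \<cdot> u = u" and no: no_orthogonal_idempotents
    and x: "P11 u x" "x \<cdot> x = k \<odot> u" "\<And>c. x \<noteq> c \<odot> u"
  shows "k = 0"
proof (rule ccontr)
  assume "k \<noteq> 0"
  define s where "s = csqrt k"
  have s: "s \<noteq> 0" "k = s * s" using \<open>k \<noteq> 0\<close> by (auto simp: s_def simp flip: power2_eq_square)
  define y where "y = (1 / s) \<odot> x"
  have y: "u \<cdot> y = y" "y \<cdot> u = y" "y \<cdot> y = u"
    using x s by (simp_all add: y_def P11_def)
  have "y \<noteq> c \<odot> u" for c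
  proof
    assume "y = c \<odot> u"
    then have "s \<odot> y = (s * c) \<odot> u" by simp
    then show False using x(3)[of "s * c"] s(1) by (simp add: y_def)
  qed
  from this[of 1] this[of "-1"] have ne: "u + y \<noteq> 0" "u - y \<noteq> 0"
    by (auto simp: add_eq_0_iff)
  define g h where "g = (1 / 2) \<odot> (u + y)" and "h = (1 / 2) \<odot> (u - y)"
  have half: "(1 / 4) \<odot> z + (1 / 4) \<odot> z = (1 / 2) \<odot> z" for z :: 'a
    by (simp flip: scale_left_distrib)
  have quarter: "(1 / 4) \<odot> (z + z) = (1 / 2) \<odot> z" for z :: 'a
    by (simp add: half scale_right_distrib)
  have sq: "(u + y) \<cdot> (u + y) = (u + y) + (u + y)" "(u - y) \<cdot> (u - y) = (u - y) + (u - y)"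
    by (simp_all add: u y algebra_simps)
  have "g \<cdot> g = (1 / 4) \<odot> ((u + y) \<cdot> (u + y))" "h \<cdot> h = (1 / 4) \<odot> ((u - y) \<cdot> (u - y))"
    unfolding g_def h_def mult_linear(7,8) by simp_all
  then have "g \<cdot> g = g" "h \<cdot> h = h" unfolding sq quarter g_def h_def .
  moreover have "g \<cdot> h = 0" "h \<cdot> g = 0"
    unfolding g_def h_def mult_linear(7,8) by (simp_all add: u y algebra_simps)
  ultimately have "g = 0 \<or> h = 0" using no unfolding no_orthogonal_idempotents_def by blast
  then show False using ne by (auto simp: g_def h_def)
qed

text \<open>For nonzero k the vector v / k would be an idempotent orthogonal to u.\<close>

lemma P00_idempotent_multiple:
  assumes uu: "u \<cdot> u = u" "u \<noteq> 0" and no: no_orthogonal_idempotents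
    and v: "P00 u v" and vv: "v \<cdot> v = k \<odot> v"
  shows "v \<cdot> v = 0"
proof (cases "k = 0")
  case False
  define h where "h = (1 / k) \<odot> v"
  have "h \<cdot> h = h" "u \<cdot> h = 0" "h \<cdot> u = 0"
    using False v by (simp_all add: h_def vv P00_def)
  then have "h = 0" using no uu unfolding no_orthogonal_idempotents_def by blast
  then show ?thesis using False by (simp add: h_def)
qed (simp add: vv)

lemma indep3_swap: "indep3 u v w \<Longrightarrow> indep3 v u w"
  unfolding indep3_def by (metis add.commute)

lemma scale_double: "(2 * k) \<odot> x = k \<odot> x + k \<odot> x"
  by (metis mult_2 scale_left_distrib)

text \<open>Multiplying the relation by z twice gives b z^3 = 0. If b = 0, one multiplication
  already gives c z^3 = 0, and c = 0 also makes z^3 vanish.\<close>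

lemma cube_zero:
  assumes "z \<cdot> z \<cdot> z \<cdot> z = 0" and rel: "z \<cdot> z \<cdot> z = b \<odot> z + c \<odot> (z \<cdot> z)"
  shows "z \<cdot> z \<cdot> z = 0"
proof -
  have 1: "b \<odot> (z \<cdot> z) + c \<odot> (z \<cdot> z \<cdot> z) = 0"
    using arg_cong[OF rel, of "\<lambda>y. y \<cdot> z"] assms(1) by simp
  have 2: "b \<odot> (z \<cdot> z \<cdot> z) = 0"
    using arg_cong[OF 1, of "\<lambda>y. y \<cdot> z"] assms(1) by simp
  show ?thesis
  proof (cases "b = 0")
    case True
    with 1 rel show ?thesis by auto
  qed (use 2 in simp)
qed

text \<open>With x x = 0, right alternativity gives (x y) x = x (x y + y x).\<close>

lemma anticommuting_right_zero:
  assumes "x \<cdot> x = 0" "x \<cdot> y + y \<cdot> x = 0"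
  shows "x \<cdot> y \<cdot> x = 0"
proof -
  have "x \<cdot> (x \<cdot> y + y \<cdot> x) = x \<cdot> y \<cdot> x"
    using right_alt[of x x y] by (simp add: assms(1))
  then show ?thesis by (simp add: assms(2))
qed

text \<open>Otherwise z produces an idempotent inside A_00, hence orthogonal to u.\<close>

lemma P00_nil:
  assumes uu: "u \<cdot> u = u" "u \<noteq> 0" and no: no_orthogonal_idempotents and z: "P00 u z"
  shows "z \<cdot> z \<cdot> z \<cdot> z = 0"
proof (rule ccontr)
  assume "z \<cdot> z \<cdot> z \<cdot> z \<noteq> 0"
  then obtain f where f: "f \<noteq> 0" "f \<cdot> f = f"
    "\<And>S. z \<in> S \<Longrightarrow> (\<And>x y. x \<in> S \<Longrightarrow> y \<in> S \<Longrightarrow> x + y \<in> S) \<Longrightarrow> (\<And>k y. y \<in> S \<Longrightarrow> k \<odot> y \<in> S) \<Longrightarrow>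
        (\<And>y. y \<in> S \<Longrightarrow> y \<cdot> z \<in> S) \<Longrightarrow> f \<in> S"
    by (rule idempotent_of_not_nil) blast
  have "f \<in> Collect (P00 u)"
    by (rule f(3)) (use z P00_mult in \<open>auto simp: P00_def\<close>)
  then show False using no f uu unfolding no_orthogonal_idempotents_def P00_def by blast
qed

text \<open>Nilpotency makes z and z^2 complete u to a basis and forces z^3 = 0, which is the table
  of \<open>A11\<close>.\<close>

lemma P00_square_nonzero:
  assumes uu: "u \<cdot> u = u" "u \<noteq> 0" and no: no_orthogonal_idempotents
    and z: "P00 u z" "z \<cdot> z \<noteq> 0"
  shows classified
proof -
  have z4: "z \<cdot> z \<cdot> z \<cdot> z = 0" by (rule P00_nil[OF uu no z(1)])
  have P: "P00 u (z \<cdot> z)" "P00 u (z \<cdot> z \<cdot> z)" using z P00_mult by blast+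
  have ind: "indep3 u z (z \<cdot> z)"
    unfolding indep3_def
  proof (intro allI impI)
    fix a b c assume rel: "a \<odot> u + b \<odot> z + c \<odot> (z \<cdot> z) = 0"
    have a: "a = 0"
      using arg_cong[OF rel, of "\<lambda>y. y \<cdot> u"] z P uu by (simp add: P00_def)
    have r: "b \<odot> (z \<cdot> z) + c \<odot> (z \<cdot> z \<cdot> z) = 0"
      using arg_cong[OF rel, of "\<lambda>y. y \<cdot> z"] a by simp
    have r': "b \<odot> (z \<cdot> z \<cdot> z) = 0"
      using arg_cong[OF r, of "\<lambda>y. y \<cdot> z"] z4 by simp
    have "b = 0" using r r' z(2) by (cases "b = 0") auto
    with a rel z(2) show "a = 0 \<and> b = 0 \<and> c = 0" by simp
  qed
  obtain a b c where rel: "z \<cdot> z \<cdot> z = a \<odot> u + b \<odot> z + c \<odot> (z \<cdot> z)"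
    using indep3_span[OF ind] by blast
  have "a = 0"
    using arg_cong[OF rel, of "\<lambda>y. y \<cdot> u"] z P uu by (simp add: P00_def)
  with rel have z3: "z \<cdot> z \<cdot> z = 0" by (intro cube_zero[OF z4, of b c]) simp
  have "z \<cdot> (z \<cdot> z) = 0" "z \<cdot> z \<cdot> (z \<cdot> z) = 0"
    using right_alt_square[of z z] right_alt_square[of "z \<cdot> z" z] by (simp_all add: z3)
  then show ?thesis
    by (intro classifiedI[OF _ A11_def[unfolded comm_table_mult_def] ind])
      (use z P uu z3 in \<open>auto simp: table_simps P00_def\<close>)
qed

lemma unital_cube_zero_square_nonzero:
  assumes unit: "\<And>x. u \<cdot> x = x" "\<And>x. x \<cdot> u = x" and n: "n \<cdot> n \<noteq> 0" "n \<cdot> n \<cdot> n = 0"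
  shows classified
proof -
  have n': "n \<cdot> (n \<cdot> n) = 0" "n \<cdot> n \<cdot> (n \<cdot> n) = 0"
    using right_alt_square[of n n] right_alt_square[of "n \<cdot> n" n] by (simp_all add: n)
  have ind: "indep3 u n (n \<cdot> n)"
    unfolding indep3_def
  proof (intro allI impI)
    fix a b c assume rel: "a \<odot> u + b \<odot> n + c \<odot> (n \<cdot> n) = 0"
    have a: "a = 0"
      using arg_cong[OF rel, of "\<lambda>y. y \<cdot> (n \<cdot> n)"] n n' unit by simp
    have "b = 0"
      using arg_cong[OF rel, of "\<lambda>y. y \<cdot> n"] n n' unit a by simp
    with a rel n show "a = 0 \<and> b = 0 \<and> c = 0" by simp
  qed
  show ?thesis
    by (intro classifiedI[OF _ A10_def[unfolded comm_table_mult_def] ind])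
      (use n n' unit in \<open>auto simp: table_simps\<close>)
qed

end

subsection \<open>Coordinates\<close>

locale dim3_basis = dim3_algebra +
  fixes u v w :: 'a
  assumes indep: "indep3 u v w"
begin

text \<open>Wrapping a linear combination in a function lets the simplifier compare coefficients, so
  that identities become polynomial equations in the structure constants.\<close>

definition cmb :: "complex \<Rightarrow> complex \<Rightarrow> complex \<Rightarrow> 'a" where
  "cmb a b c = a \<odot> u + b \<odot> v + c \<odot> w"

lemma cmb_eq_0: "cmb a b c = 0 \<longleftrightarrow> a = 0 \<and> b = 0 \<and> c = 0"
  using indep unfolding indep3_def cmb_def by auto

lemma cmb_add: "cmb a b c + cmb a' b' c' = cmb (a + a') (b + b') (c + c')"
  by (simp add: cmb_def algebra_simps)

lemma cmb_diff: "cmb a b c - cmb a' b' c' = cmb (a - a') (b - b') (c - c')"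
  by (simp add: cmb_def algebra_simps)

lemma cmb_minus: "- cmb a b c = cmb (- a) (- b) (- c)"
  by (simp add: cmb_def)

lemma cmb_scale: "k \<odot> cmb a b c = cmb (k * a) (k * b) (k * c)"
  by (simp add: cmb_def scale_right_distrib)

lemma cmb_eq: "cmb a b c = cmb a' b' c' \<longleftrightarrow> a = a' \<and> b = b' \<and> c = c'"
  using cmb_eq_0[of "a - a'" "b - b'" "c - c'"] unfolding cmb_diff[symmetric] by auto

lemma cmb_eq_0': "0 = cmb a b c \<longleftrightarrow> a = 0 \<and> b = 0 \<and> c = 0"
  using cmb_eq_0 by metis

lemma cmb_mult:
  "cmb a b c \<cdot> x = a \<odot> (u \<cdot> x) + b \<odot> (v \<cdot> x) + c \<odot> (w \<cdot> x)"
  "x \<cdot> cmb a b c = a \<odot> (x \<cdot> u) + b \<odot> (x \<cdot> v) + c \<odot> (x \<cdot> w)"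
  by (simp_all add: cmb_def)

lemma basis_cmb: "u = cmb 1 0 0" "v = cmb 0 1 0" "w = cmb 0 0 1"
  by (simp_all add: cmb_def)

lemma cmb_exhaust: obtains a b c where "x = cmb a b c"
  using indep3_span[OF indep] unfolding cmb_def by blast

lemmas cmb_simps = cmb_add cmb_diff cmb_minus cmb_scale cmb_eq cmb_eq_0 cmb_eq_0' cmb_mult

subsection \<open>A single idempotent\<close>

text \<open>Completing the square: if v v = a u + b v, then v - (b/2) u squares to a multiple of u,
  which is zero by \<open>unital_square_zero\<close>. The condition on w keeps w out of v v.\<close>

lemma nilpotent_P11_vector:
  assumes uu: "u \<cdot> u = u" and no: no_orthogonal_idempotents
    and v: "P11 u v" and w: "w \<cdot> u = 0 \<or> u \<cdot> w = 0"
  obtains n where "P11 u n" "n \<cdot> n = 0" "indep3 u n w"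
proof -
  have p: "u \<cdot> u = cmb 1 0 0" "u \<cdot> v = cmb 0 1 0" "v \<cdot> u = cmb 0 1 0"
    using uu v by (simp_all add: P11_def cmb_def)
  obtain a b c where "v \<cdot> v = cmb a b c" by (rule cmb_exhaust)
  then have vv: "v \<cdot> v = cmb a b 0"
    using P11_mult[OF v v] w by (auto simp: P11_def p cmb_simps)
  define n where "n = cmb (- b / 2) 1 0"
  have nn: "n \<cdot> n = cmb (a + b * b / 4) 0 0" by (simp add: n_def p vv cmb_simps)
  have P11: "P11 u n" unfolding P11_def by (simp add: n_def p cmb_simps)
  have "a + b * b / 4 = 0"
  proof (rule unital_square_zero[OF uu no P11])
    show "n \<noteq> c \<odot> u" for c using cmb_eq[of "- b / 2" 1 0 c 0 0] by (simp add: n_def cmb_def)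
    show "n \<cdot> n = (a + b * b / 4) \<odot> u" using nn by (simp add: cmb_def)
  qed
  moreover have "indep3 (cmb 1 0 0) n (cmb 0 0 1)"
    by (auto simp: indep3_def n_def cmb_simps)
  then have "indep3 u n w" by (simp add: cmb_def)
  ultimately show thesis using that P11 nn by (simp add: cmb_simps)
qed

lemma u_nonzero: "u \<noteq> 0"
  using cmb_eq_0[of 1 0 0] by (simp add: cmb_def)

lemma right_fixed_multiple:
  assumes "u \<cdot> u = u" "v \<cdot> u = 0" "w \<cdot> u = 0" "z \<cdot> u = z"
  shows "\<exists>k. z = k \<odot> u"
proof -
  obtain a b c where z: "z = cmb a b c" by (rule cmb_exhaust)
  have "u \<cdot> u = cmb 1 0 0" using assms(1) by (simp add: cmb_def)
  then have "z = cmb a 0 0" using assms(2-4) z by (simp add: cmb_simps)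
  then show ?thesis by (auto simp: cmb_def)
qed

text \<open>The digits in the names of this lemma and its companions are the Peirce types of
  \<open>v\<close> and \<open>w\<close>. In each, the identities are evaluated at basis vectors, in
  an order in which constants already found simplify the next equation.\<close>

lemma peirce_11_00_classified:
  assumes uu: "u \<cdot> u = u" and no: no_orthogonal_idempotents
    and v: "P11 u v" and w: "P00 u w"
    and vv: "v \<cdot> v = 0"
  shows classified
proof -
  have p: "u \<cdot> u = cmb 1 0 0" "u \<cdot> v = cmb 0 1 0" "v \<cdot> u = cmb 0 1 0"
    "u \<cdot> w = 0" "w \<cdot> u = 0" "v \<cdot> w = 0" "w \<cdot> v = 0"
    using uu v w P11_P00_zero[OF uu v w] by (simp_all add: P11_def P00_def cmb_def)
  obtain a b c where "w \<cdot> w = cmb a b c" by (rule cmb_exhaust)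
  then have "w \<cdot> w = cmb 0 0 c" using P00_mult[OF w w] by (simp add: P00_def p cmb_simps)
  then have "w \<cdot> w = c \<odot> w" by (simp add: cmb_def)
  then have ww: "w \<cdot> w = 0"
    using P00_idempotent_multiple[OF uu u_nonzero no w] by blast
  show ?thesis
    by (rule classifiedI[OF _ A02_def[unfolded comm_table_mult_def], where u = "cmb 1 0 0" and v = "cmb 0 1 0" and w = "cmb 0 0 1"])
      (auto simp: table_simps indep3_def cmb_simps p vv ww)
qed

lemma peirce_11_10_classified:
  assumes uu: "u \<cdot> u = u" and no: no_orthogonal_idempotents
    and v: "P11 u v" and w: "P10 u w"
    and vv: "v \<cdot> v = 0"
  shows classified
proof -
  obtain a b c where uw: "u \<cdot> w = cmb a b c" by (rule cmb_exhaust)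
  have "w = cmb 0 0 1" by (simp add: cmb_def)
  then have "cmb a b (c - 1) \<cdot> u = cmb a b (c - 1)"
    using w uw unfolding P10_def P11_def by (metis cmb_diff diff_zero)
  then have "cmb a b 0 = cmb a b (c - 1)"
    using uu v w unfolding cmb_mult P10_def P11_def by (simp add: cmb_def)
  then have c: "c = 1" by (simp add: cmb_eq)
  have p: "u \<cdot> u = cmb 1 0 0" "u \<cdot> v = cmb 0 1 0" "v \<cdot> u = cmb 0 1 0"
    "u \<cdot> w = cmb a b 1" "w \<cdot> u = 0"
    using uu v w uw c by (simp_all add: P11_def P10_def cmb_def)
  obtain x y z where "w \<cdot> v = cmb x y z" by (rule cmb_exhaust)
  then have wv: "w \<cdot> v = 0" using right_alt[of w u v] by (simp add: p cmb_simps)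
  obtain h t s where ww: "w \<cdot> w = cmb h t s" by (rule cmb_exhaust)
  have s: "s = 0" using right_alt[of w u w] by (simp add: p wv ww cmb_simps)
  obtain x y z where vw: "v \<cdot> w = cmb x y z" by (rule cmb_exhaust)
  have xy: "x = 0" "y = a" using right_alt[of v u w] by (simp_all add: p vv wv vw cmb_simps)
  have z: "z = 0" using right_alt[of v v w] by (simp add: p vv wv vw xy cmb_simps)
  have a: "a = 0" using right_alt_square[of u w] by (simp add: p vw ww s xy z cmb_simps)
  have h: "h = 0" using right_alt_square[of w w] by (simp add: p wv vw ww s xy z a cmb_simps)
  note p = p vv wv vw ww s xy z a h
  \<comment> \<open>What remains is u w = w + b v and w w = t v.\<close>
  consider "t \<noteq> 0" | "t = 0" "b = 0" | "t = 0" "b \<noteq> 0" by blast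
  then show ?thesis
  proof cases
    case 1
    \<comment> \<open>Replacing \<open>u\<close> by another idempotent makes its left multiplication diagonalisable.\<close>
    show ?thesis
      by (rule classifiedI[OF _ R10_def, where u = "cmb 1 0 (- (b / t))" and v = "cmb 0 b 1" and w = "cmb 0 t 0"])
        (use 1 in \<open>auto simp: table_simps indep3_def cmb_simps p\<close>)
  next
    case 2
    show ?thesis
      by (rule classifiedI[OF _ R03_def, where u = "cmb 1 0 0" and v = "cmb 0 0 1" and w = "cmb 0 1 0"])
        (use 2 in \<open>auto simp: table_simps indep3_def cmb_simps p\<close>)
  next
    case 3
    \<comment> \<open>The factor b in the new basis vectors normalises the only parameter left to
      1.\<close>
    show ?thesis
      by (rule classifiedI[OF _ R04_def, where u = "cmb 1 0 0" and v = "cmb 0 (- b) 1" and w = "cmb 0 b 0"])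
        (use 3 in \<open>auto simp: table_simps indep3_def cmb_simps p\<close>)
  qed
qed

lemma peirce_11_01_classified:
  assumes uu: "u \<cdot> u = u" and no: no_orthogonal_idempotents
    and v: "P11 u v" and w: "P01 u w"
    and vv: "v \<cdot> v = 0"
  shows classified
proof -
  obtain a b c where "u \<cdot> w = cmb a b c" by (rule cmb_exhaust)
  moreover have p: "u \<cdot> u = cmb 1 0 0" "u \<cdot> v = cmb 0 1 0" "v \<cdot> u = cmb 0 1 0" "w \<cdot> u = cmb 0 0 1"
    using uu v w by (simp_all add: P11_def P01_def cmb_def)
  \<comment> \<open>R is the identity on the basis, so A_00 = 0, and u w lies in it.\<close>
  ultimately have uw: "u \<cdot> w = 0" using w by (simp add: P01_def P00_def cmb_simps)
  obtain x y z where "v \<cdot> w = cmb x y z" by (rule cmb_exhaust)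
  then have vw: "v \<cdot> w = 0" using right_alt[of v u w] by (simp add: p uw cmb_simps)
  obtain x y z where wv: "w \<cdot> v = cmb x y z" by (rule cmb_exhaust)
  have xy: "x = 0" "y = 0" using cyclic[of u w v] by (simp_all add: p uw vw wv cmb_simps)
  have z: "z = 0" using right_alt_square[of w v] by (simp add: p uw vv vw wv xy cmb_simps)
  obtain x' y' z' where "w \<cdot> w = cmb x' y' z'" by (rule cmb_exhaust)
  then have ww: "w \<cdot> w = 0" using right_alt[of w u w] by (simp add: p uw cmb_simps)
  show ?thesis
    by (rule classifiedI[OF _ R05_def, where u = "cmb 1 0 0" and v = "cmb 0 0 1" and w = "cmb 0 1 0"])
      (auto simp: table_simps indep3_def cmb_simps p uw vv vw wv xy z ww)
qed

lemma peirce_00_10_classified: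
  assumes uu: "u \<cdot> u = u" and no: no_orthogonal_idempotents
    and v: "P00 u v" and w: "P10 u w"
  shows classified
proof -
  have p: "u \<cdot> u = cmb 1 0 0" "u \<cdot> v = 0" "v \<cdot> u = 0" "w \<cdot> u = 0"
    using uu v w by (simp_all add: P00_def P10_def cmb_def)
  from P10_one_dim[OF uu u_nonzero w right_fixed_multiple[OF uu p(3,4)]] have p: "u \<cdot> u = cmb 1 0 0" "u \<cdot> v = 0" "v \<cdot> u = 0" "w \<cdot> u = 0"
    "u \<cdot> w = cmb 0 0 1" "w \<cdot> w = 0" using p by (simp_all add: cmb_def)
  obtain a b c where "v \<cdot> v = cmb a b c" by (rule cmb_exhaust)
  then have "v \<cdot> v = cmb 0 b 0" using P00_mult[OF v v] by (simp add: P00_def p cmb_simps)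
  then have vv: "v \<cdot> v = 0" using P00_idempotent_multiple[OF uu u_nonzero no v, of b] by (simp add: cmb_def)
  obtain x y z where vw: "v \<cdot> w = cmb x y z" by (rule cmb_exhaust)
  have yz: "y = 0" "z = 0" using right_alt[of v u w] by (simp_all add: p vv vw cmb_simps)
  obtain x' y' z' where wv: "w \<cdot> v = cmb x' y' z'" by (rule cmb_exhaust)
  have x': "x' = 0" using right_alt[of w u v] by (simp add: p vv vw wv cmb_simps)
  have xy': "x = 0" "y' = 0" using cyclic[of u w v] by (simp_all add: p vv vw wv yz x' cmb_simps)
  have z': "z' = 0" using right_alt_square[of w v] by (simp add: p vv vw wv yz x' xy' cmb_simps)
  show ?thesis
    by (rule classifiedI[OF _ R14_def, where u = "cmb 1 0 0" and v = "cmb 0 0 1" and w = "cmb 0 1 0"])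
      (auto simp: table_simps indep3_def cmb_simps p vv vw wv yz x' xy' z')
qed

lemma peirce_00_01_classified:
  assumes uu: "u \<cdot> u = u" and no: no_orthogonal_idempotents
    and v: "P00 u v" and w: "P01 u w"
  shows classified
proof -
  have p: "u \<cdot> u = cmb 1 0 0" "u \<cdot> v = 0" "v \<cdot> u = 0" "w \<cdot> u = cmb 0 0 1"
    using uu v w by (simp_all add: P00_def P01_def cmb_def)
  obtain a k c where "u \<cdot> w = cmb a k c" by (rule cmb_exhaust)
  then have uw: "u \<cdot> w = cmb 0 k 0" using w by (simp add: P01_def P00_def p cmb_simps)
  obtain a b c where "v \<cdot> v = cmb a b c" by (rule cmb_exhaust)
  then have "v \<cdot> v = cmb 0 b 0" using P00_mult[OF v v] by (simp add: P00_def p cmb_simps)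
  then have vv: "v \<cdot> v = 0" using P00_idempotent_multiple[OF uu u_nonzero no v, of b] by (simp add: cmb_def)
  obtain x y z where "w \<cdot> v = cmb x y z" by (rule cmb_exhaust)
  then have wv: "w \<cdot> v = 0" using right_alt[of w u v] by (simp add: p uw vv cmb_simps)
  obtain x y z where vw: "v \<cdot> w = cmb x y z" by (rule cmb_exhaust)
  have y: "y = 0" using right_alt[of v u w] by (simp add: p uw vv vw cmb_simps)
  have x: "x = 0" using cyclic[of u v w] by (simp add: p uw vv vw wv y cmb_simps)
  have z: "z = 0" using right_alt[of v v w] by (simp add: p uw vv vw wv x y cmb_simps)
  obtain a t c where "w \<cdot> w = cmb a t c" by (rule cmb_exhaust)
  then have ww: "w \<cdot> w = cmb 0 t 0" using right_alt[of w u w] by (simp add: p uw vv vw wv cmb_simps)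
  note p = p uw vv wv vw x y z ww
  \<comment> \<open>What remains is u w = k v and w w = t v.\<close>
  consider "t \<noteq> 0" | "t = 0" "k = 0" | "t = 0" "k \<noteq> 0" by blast
  then show ?thesis
  proof cases
    case 1
    \<comment> \<open>Replacing \<open>u\<close> by another idempotent makes its left multiplication diagonalisable.\<close>
    show ?thesis
      by (rule classifiedI[OF _ R09_def, where u = "cmb 1 0 (- (k / t))" and v = "cmb 0 (- k) 1" and w = "cmb 0 t 0"])
        (use 1 in \<open>auto simp: table_simps indep3_def cmb_simps p\<close>)
  next
    case 2
    show ?thesis
      by (rule classifiedI[OF _ R12_def, where u = "cmb 1 0 0" and v = "cmb 0 0 1" and w = "cmb 0 1 0"])
        (use 2 in \<open>auto simp: table_simps indep3_def cmb_simps p\<close>)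
  next
    case 3
    show ?thesis
      by (rule classifiedI[OF _ R13_def, where u = "cmb 1 0 0" and v = "cmb 0 k 1" and w = "cmb 0 k 0"])
        (use 3 in \<open>auto simp: table_simps indep3_def cmb_simps p\<close>)
  qed
qed

lemma peirce_10_10_classified:
  assumes uu: "u \<cdot> u = u" and no: no_orthogonal_idempotents
    and v: "P10 u v" and w: "P10 u w"
  shows classified
proof -
  have p: "u \<cdot> u = cmb 1 0 0" "v \<cdot> u = 0" "w \<cdot> u = 0"
    using uu v w by (simp_all add: P10_def cmb_def)
  note * = P10_one_dim[OF uu u_nonzero _ right_fixed_multiple[OF uu p(2,3)]]
  \<comment> \<open>Squares vanish on all vectors of this type, so the square of v + w gives
    anticommutativity.\<close>
  have "P10 u (v + w)" using *[OF v] *[OF w] v w by (simp add: P10_def P11_def)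
  from *(2)[OF this] *[OF v] *[OF w] have anti: "v \<cdot> w + w \<cdot> v = 0"
    and p: "u \<cdot> u = cmb 1 0 0" "v \<cdot> u = 0" "w \<cdot> u = 0"
    "u \<cdot> v = cmb 0 1 0" "v \<cdot> v = 0" "u \<cdot> w = cmb 0 0 1" "w \<cdot> w = 0" using p by (simp_all add: cmb_def add.commute)
  obtain x y z where vw: "v \<cdot> w = cmb x y z" by (rule cmb_exhaust)
  have yz: "y = 0" "z = 0" using right_alt[of v u w] by (simp_all add: p vw cmb_simps)
  obtain x' y' z' where wv: "w \<cdot> v = cmb x' y' z'" by (rule cmb_exhaust)
  have yz': "y' = 0" "z' = 0" using right_alt[of w u v] by (simp_all add: p wv cmb_simps)
  \<comment> \<open>The cyclic identity makes v and w commute; as they also anticommute, v w =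
    0.\<close>
  have "x' = x" using cyclic[of u v w] by (simp add: p vw wv yz yz' cmb_simps)
  with anti have x: "x = 0" "x' = 0" by (auto simp: vw wv cmb_simps)
  show ?thesis
    by (rule classifiedI[OF _ R06_def, where u = "cmb 1 0 0" and v = "cmb 0 1 0" and w = "cmb 0 0 1"])
      (auto simp: table_simps indep3_def cmb_simps p vw wv yz yz' x)
qed

text \<open>Here u is a right unit, so A_00 = 0 and L kills v and w; by right alternativity every
  product with such a vector on the right is zero.\<close>

lemma peirce_01_01_classified:
  assumes uu: "u \<cdot> u = u" and no: no_orthogonal_idempotents
    and v: "P01 u v" and w: "P01 u w"
  shows classified
proof -
  have p: "u \<cdot> u = cmb 1 0 0" "v \<cdot> u = cmb 0 1 0" "w \<cdot> u = cmb 0 0 1"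
    using uu v w by (simp_all add: P01_def cmb_def)
  have right_unit: "x \<cdot> u = x" for x
  proof -
    obtain a b c where "x = cmb a b c" by (rule cmb_exhaust)
    then show ?thesis by (simp add: p cmb_simps)
  qed
  have uv: "u \<cdot> v = 0" and uw: "u \<cdot> w = 0"
    using v w right_unit by (simp_all add: P01_def P00_def)
  have zero: "x \<cdot> y = 0" if "u \<cdot> y = 0" for x y
    using right_alt[of x u y] by (simp add: that right_unit)
  show ?thesis
    by (rule classifiedI[OF _ R07_def, where u = "cmb 1 0 0" and v = "cmb 0 1 0" and w = "cmb 0 0 1"])
      (auto simp: table_simps indep3_def cmb_simps p zero[OF uv] zero[OF uw])
qed

lemma peirce_10_01_classified:
  assumes uu: "u \<cdot> u = u" and no: no_orthogonal_idempotents
    and v: "P10 u v" and w: "P01 u w"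
  shows classified
proof -
  have p: "u \<cdot> u = cmb 1 0 0" "v \<cdot> u = 0" "w \<cdot> u = cmb 0 0 1"
    using uu v w by (simp_all add: P01_def P10_def cmb_def)
  obtain a b c where uv: "u \<cdot> v = cmb a b c" by (rule cmb_exhaust)
  obtain a' b' c' where uw: "u \<cdot> w = cmb a' b' c'" by (rule cmb_exhaust)
  have "v = cmb 0 1 0" by (simp add: cmb_def)
  then have "P11 u (cmb a (b - 1) c)" using v uv unfolding P10_def by (metis cmb_diff diff_zero)
  then have b: "b = 1" by (simp add: P11_def p cmb_simps)
  have ac': "a' = 0" "c' = 0" using w by (simp_all add: P01_def P00_def p uw cmb_simps)
  have b': "b' = 0" using w by (simp add: P01_def P00_def p uw uv ac' b cmb_simps)
  have c: "c = 0" using \<open>P11 u (cmb a (b - 1) c)\<close> by (simp add: P11_def p uw ac' b b' cmb_simps)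
  note p = p uv uw b ac' b' c
  obtain d y g where vv: "v \<cdot> v = cmb d y g" by (rule cmb_exhaust)
  have y: "y = 0" using right_alt[of v u v] by (simp add: p vv cmb_simps)
  have a: "a = 0" "g = 0" using right_alt_square[of u v] by (simp_all add: p vv y cmb_simps)
  have d: "d = 0" using right_alt_square[of v v] by (simp add: p vv a y cmb_simps)
  note p = p vv y a d
  obtain x y z where ww: "w \<cdot> w = cmb x y z" by (rule cmb_exhaust)
  have xz: "x = 0" "z = 0" using right_alt[of w u w] by (simp_all add: p ww cmb_simps)
  have y: "y = 0" using cyclic[of u w w] by (simp add: p ww xz cmb_simps)
  note p = p ww xz y
  obtain q r s where vw: "v \<cdot> w = cmb q r s" by (rule cmb_exhaust)
  have r: "r = 0" using right_alt[of v u w] by (simp add: p vw cmb_simps)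
  obtain q' r' s' where wv: "w \<cdot> v = cmb q' r' s'" by (rule cmb_exhaust)
  have qs': "q' = 0" "s' = 0" using right_alt[of w u v] by (simp_all add: p wv cmb_simps)
  have s: "s = 0" using cyclic[of u v w] by (simp add: p vw wv r qs' cmb_simps)
  have r': "r' = 0" using cyclic[of u w v] by (simp add: p vw wv r qs' s cmb_simps)
  have q: "q = 0" using right_alt[of v v w] by (simp add: p vw wv r qs' s r' cmb_simps)
  show ?thesis
    by (rule classifiedI[OF _ R08_def, where u = "cmb 1 0 0" and v = "cmb 0 0 1" and w = "cmb 0 1 0"])
      (auto simp: table_simps indep3_def cmb_simps p vw wv r qs' s r' q)
qed

text \<open>A nonzero square in A_00 leads to \<open>A11\<close>. Otherwise v and w anticommute, and
  (v w) v = 0 = (w v) w leaves only v w = 0.\<close>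

lemma peirce_00_00_classified:
  assumes uu: "u \<cdot> u = u" and no: no_orthogonal_idempotents
    and v: "P00 u v" and w: "P00 u w"
  shows classified
proof (cases "\<exists>z. P00 u z \<and> z \<cdot> z \<noteq> 0")
  case True
  then show ?thesis using P00_square_nonzero[OF uu u_nonzero no] by blast
next
  case False
  have p: "u \<cdot> u = cmb 1 0 0" "u \<cdot> v = 0" "v \<cdot> u = 0" "u \<cdot> w = 0" "w \<cdot> u = 0"
    using uu v w by (simp_all add: P00_def cmb_def)
  have "P00 u (v + w)" using v w by (simp add: P00_def)
  with False v w have "v \<cdot> v = 0" "w \<cdot> w = 0" "(v + w) \<cdot> (v + w) = 0" by blast+
  then have sq: "v \<cdot> v = 0" "w \<cdot> w = 0" and anti: "v \<cdot> w + w \<cdot> v = 0"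
    by (simp_all add: add.commute)
  from anti have wv: "w \<cdot> v = - (v \<cdot> w)" by (simp add: eq_neg_iff_add_eq_0 add.commute)
  obtain a b c where vw: "v \<cdot> w = cmb a b c" by (rule cmb_exhaust)
  have a: "a = 0" using P00_mult[OF v w] by (simp add: vw P00_def p cmb_simps)
  have c: "c = 0" using anticommuting_right_zero[OF sq(1) anti]
    by (simp add: vw wv sq a p cmb_simps)
  have b: "b = 0" using anticommuting_right_zero[of w v] sq anti
    by (simp add: vw wv a c p cmb_simps add.commute)
  show ?thesis
    by (rule classifiedI[OF _ A03_def[unfolded comm_table_mult_def] indep])
      (auto simp: table_simps uu sq vw wv a b c cmb_def p)
qed

lemma unital_anticommuting:
  assumes unit: "\<And>x. u \<cdot> x = x" "\<And>x. x \<cdot> u = x"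
    and sq: "v \<cdot> v = 0" "w \<cdot> w = 0" and anti: "v \<cdot> w + w \<cdot> v = 0"
  shows classified
proof -
  from anti have wv: "w \<cdot> v = - (v \<cdot> w)" by (simp add: eq_neg_iff_add_eq_0 add.commute)
  have b: "v = cmb 0 1 0" "w = cmb 0 0 1" by (simp_all add: cmb_def)
  obtain a b c where vw: "v \<cdot> w = cmb a b c" by (rule cmb_exhaust)
  \<comment> \<open>This is (v w) v = a v + c (w v) in coordinates.\<close>
  have "a \<odot> cmb 0 1 0 + c \<odot> cmb (- a) (- b) (- c) = 0"
    using anticommuting_right_zero[OF sq(1) anti] unfolding b(1)[symmetric] cmb_minus[symmetric]
    by (simp add: vw wv sq unit cmb_mult)
  then have c: "c = 0" "a = 0" by (auto simp: cmb_simps)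
  have b: "b = 0" using anticommuting_right_zero[of w v] sq anti
    by (simp add: vw wv c cmb_simps add.commute)
  show ?thesis
    by (rule classifiedI[OF _ A09_def[unfolded comm_table_mult_def] indep])
      (auto simp: table_simps unit sq vw wv b c cmb_def)
qed

text \<open>For a root k of the cubic satisfied by v, the cube of n = v - k u is a combination of n
  and n^2 without constant term. If n were not nilpotent, an idempotent f in the span of n and n^2
  would make f, u - f orthogonal.\<close>

lemma unital_cubic_shift:
  assumes unit: "\<And>x. u \<cdot> x = x" "\<And>x. x \<cdot> u = x" and no: no_orthogonal_idempotents
    and sq: "v \<cdot> v = w"
  obtains k where "(v - k \<odot> u) \<cdot> (v - k \<odot> u) \<cdot> (v - k \<odot> u) = 0"
proof -
  obtain a b c where wv: "w \<cdot> v = cmb a b c" by (rule cmb_exhaust)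
  have p: "u \<cdot> u = cmb 1 0 0" "u \<cdot> v = cmb 0 1 0" "v \<cdot> u = cmb 0 1 0"
    "u \<cdot> w = cmb 0 0 1" "w \<cdot> u = cmb 0 0 1" "v \<cdot> v = cmb 0 0 1"
    "v \<cdot> w = cmb a b c"
    using wv right_alt_square[of v v] by (simp_all add: unit sq cmb_def)
  have "\<not> constant (poly [:- a, - b, - c, 1:])" by (simp add: constant_degree)
  then obtain k where "poly [:- a, - b, - c, 1:] k = 0" using fundamental_theorem_of_algebra by blast
  then have a: "a = k * k * k - b * k - c * k * k" by (simp add: algebra_simps)
  define n where "n = cmb (- k) 1 0"
  have n: "n = v - k \<odot> u" by (simp add: n_def cmb_def)
  have nn: "n \<cdot> n = cmb (k * k) (- 2 * k) 1"
    unfolding n_def cmb_mult p by (simp add: cmb_simps)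
  have nx: "cmb p q r \<cdot> n = cmb (r * a - k * p) (p + r * b - k * q) (q + r * c - k * r)" for p q r
    unfolding n_def cmb_mult p wv by (simp add: cmb_simps)
  \<comment> \<open>The negated Taylor coefficients of the cubic at its root k.\<close>
  define \<gamma> \<beta> where "\<gamma> = c - 3 * k" and "\<beta> = b + 2 * k * c - 3 * k * k"
  have n3: "n \<cdot> n \<cdot> n = \<beta> \<odot> n + \<gamma> \<odot> (n \<cdot> n)"
    unfolding nn nx unfolding n_def cmb_simps by (simp add: a \<gamma>_def \<beta>_def algebra_simps)
  have "n \<cdot> n \<cdot> n \<cdot> n = 0"
  proof (rule ccontr)
    assume "n \<cdot> n \<cdot> n \<cdot> n \<noteq> 0"
    then obtain f where f: "f \<noteq> 0" "f \<cdot> f = f"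
      "\<And>S. n \<in> S \<Longrightarrow> (\<And>x y. x \<in> S \<Longrightarrow> y \<in> S \<Longrightarrow> x + y \<in> S) \<Longrightarrow> (\<And>k y. y \<in> S \<Longrightarrow> k \<odot> y \<in> S) \<Longrightarrow>
          (\<And>y. y \<in> S \<Longrightarrow> y \<cdot> n \<in> S) \<Longrightarrow> f \<in> S"
      by (rule idempotent_of_not_nil) blast
    have "f \<in> {p \<odot> n + q \<odot> (n \<cdot> n) | p q. True}"
    proof (rule f(3))
      show "n \<in> {p \<odot> n + q \<odot> (n \<cdot> n) | p q. True}"
        by (rule CollectI, rule exI[of _ 1], rule exI[of _ 0]) simp
    next
      fix y z assume "y \<in> {p \<odot> n + q \<odot> (n \<cdot> n) | p q. True}" "z \<in> {p \<odot> n + q \<odot> (n \<cdot> n) | p q. True}"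
      then obtain p q p' q' where "y = p \<odot> n + q \<odot> (n \<cdot> n)" "z = p' \<odot> n + q' \<odot> (n \<cdot> n)" by blast
      then have "y + z = (p + p') \<odot> n + (q + q') \<odot> (n \<cdot> n)" by (simp add: algebra_simps)
      then show "y + z \<in> {p \<odot> n + q \<odot> (n \<cdot> n) | p q. True}" by blast
    next
      fix k y assume "y \<in> {p \<odot> n + q \<odot> (n \<cdot> n) | p q. True}"
      then obtain p q where "y = p \<odot> n + q \<odot> (n \<cdot> n)" by blast
      then have "k \<odot> y = (k * p) \<odot> n + (k * q) \<odot> (n \<cdot> n)" by (simp add: scale_right_distrib)
      then show "k \<odot> y \<in> {p \<odot> n + q \<odot> (n \<cdot> n) | p q. True}" by blast
    next
      fix y assume "y \<in> {p \<odot> n + q \<odot> (n \<cdot> n) | p q. True}"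
      then obtain p q where "y = p \<odot> n + q \<odot> (n \<cdot> n)" by blast
      then have "y \<cdot> n = (q * \<beta>) \<odot> n + (p + q * \<gamma>) \<odot> (n \<cdot> n)"
        by (simp add: n3 algebra_simps)
      then show "y \<cdot> n \<in> {p \<odot> n + q \<odot> (n \<cdot> n) | p q. True}" by blast
    qed
    then obtain p q where pq: "f = p \<odot> n + q \<odot> (n \<cdot> n)" by blast
    \<comment> \<open>The complement u - f is an idempotent orthogonal to f; but u does not lie in
      the span of n and n^2.\<close>
    have "u - f = 0"
      using no f unfolding no_orthogonal_idempotents_def
      by (metis (no_types, lifting) mult_linear(3,4) unit diff_self diff_zero)
    then have "p \<odot> n + q \<odot> (n \<cdot> n) = cmb 1 0 0" using pq basis_cmb(1) by (metis right_minus_eq)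
    then show False unfolding nn unfolding n_def by (auto simp: cmb_simps)
  qed
  from cube_zero[OF this n3] show thesis using that n by simp
qed

subsection \<open>Two orthogonal idempotents\<close>

lemma orthogonal_11_nil:
  assumes orth: "u \<cdot> u = u" "v \<cdot> v = v" "u \<cdot> v = 0" "v \<cdot> u = 0" 
    and w: "P11 u w" "w \<cdot> w = 0"
  shows classified
proof -
  have "P00 u v" using orth by (simp add: P00_def)
  note z = P11_P00_zero[OF orth(1) w(1) this]
  have p: "u \<cdot> u = cmb 1 0 0" "v \<cdot> v = cmb 0 1 0" "u \<cdot> w = cmb 0 0 1" "w \<cdot> u = cmb 0 0 1"
    using orth w by (simp_all add: P11_def cmb_def)
  show ?thesis
    by (rule classifiedI[OF _ A08_def[unfolded comm_table_mult_def], where u = "cmb 0 1 0" and v = "cmb 1 0 0" and w = "cmb 0 0 1"])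
      (auto simp: table_simps indep3_def cmb_simps p orth(3,4) w(2) z)
qed

lemma orthogonal_11_square_root:
  assumes orth: "u \<cdot> u = u" "v \<cdot> v = v" "u \<cdot> v = 0" "v \<cdot> u = 0" 
    and w: "P11 u w" "w \<cdot> w = u"
  shows classified
proof -
  have "P00 u v" using orth by (simp add: P00_def)
  note z = P11_P00_zero[OF orth(1) w(1) this]
  have p: "u \<cdot> u = cmb 1 0 0" "v \<cdot> v = cmb 0 1 0" "u \<cdot> w = cmb 0 0 1" "w \<cdot> u = cmb 0 0 1" "w \<cdot> w = cmb 1 0 0"
    using orth w by (simp_all add: P11_def cmb_def)
  \<comment> \<open>The square root w splits u into the orthogonal idempotents (u + w)/2 and (u -
    w)/2.\<close>
  show ?thesis
    by (rule classifiedI[OF _ A07_def[unfolded comm_table_mult_def], where u = "cmb (1 / 2) 0 (1 / 2)" and v = "cmb (1 / 2) 0 (- (1 / 2))" and w = "cmb 0 1 0"])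
      (auto simp: table_simps indep3_def cmb_simps p orth(3,4) z)
qed

text \<open>Completing the square makes w w a multiple of u; scaling then makes it 0 or u.\<close>

lemma orthogonal_11:
  assumes orth: "u \<cdot> u = u" "v \<cdot> v = v" "u \<cdot> v = 0" "v \<cdot> u = 0" 
    and w: "P11 u w"
  shows classified
proof -
  have p: "u \<cdot> u = cmb 1 0 0" "u \<cdot> v = 0" "v \<cdot> u = 0" "u \<cdot> w = cmb 0 0 1" "w \<cdot> u = cmb 0 0 1"
    using orth w by (simp_all add: P11_def cmb_def)
  obtain a b c where "w \<cdot> w = cmb a b c" by (rule cmb_exhaust)
  then have ww: "w \<cdot> w = cmb a 0 c"
    using P11_mult[OF w w] by (simp add: P11_def p cmb_simps)
  define n k where "n = cmb (- c / 2) 0 1" and "k = a + c * c / 4"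
  have nn: "n \<cdot> n = k \<odot> cmb 1 0 0" by (simp add: n_def k_def p ww cmb_simps)
  have n: "P11 u n" unfolding P11_def by (simp add: n_def p cmb_simps)
  have ind: "indep3 (cmb 1 0 0) (cmb 0 1 0) (s \<odot> n)" if "s \<noteq> 0" for s
    using that by (auto simp: indep3_def n_def cmb_simps)
  show ?thesis
  proof (cases "k = 0")
    case True
    interpret B: dim3_basis scl mult u v n
      by unfold_locales (use ind[of 1] in \<open>simp add: cmb_def\<close>)
    show ?thesis by (rule B.orthogonal_11_nil[OF orth n]) (simp add: nn True)
  next
    case False
    define s where "s = csqrt k"
    have s: "s \<noteq> 0" "k = s * s" using False by (auto simp: s_def simp flip: power2_eq_square)
    interpret B: dim3_basis scl mult u v "(1 / s) \<odot> n"
      by unfold_locales (use ind[of "1 / s"] s in \<open>simp add: cmb_def\<close>)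
    show ?thesis
    proof (rule B.orthogonal_11_square_root[OF orth])
      show "P11 u ((1 / s) \<odot> n)" using n by (simp add: P11_def)
      show "(1 / s) \<odot> n \<cdot> (1 / s) \<odot> n = u" using s by (simp add: nn cmb_def)
    qed
  qed
qed

lemma orthogonal_10:
  assumes orth: "u \<cdot> u = u" "v \<cdot> v = v" "u \<cdot> v = 0" "v \<cdot> u = 0" 
    and w: "P10 u w"
  shows classified
proof -
  have p: "u \<cdot> u = cmb 1 0 0" "v \<cdot> v = cmb 0 1 0" "u \<cdot> v = 0" "v \<cdot> u = 0" and wu: "w \<cdot> u = 0"
    using orth w by (simp_all add: P10_def cmb_def)
  note one = P10_one_dim[OF orth(1) u_nonzero w right_fixed_multiple[OF orth(1,4) wu]]
  have uw: "u \<cdot> w = cmb 0 0 1" using one by (simp add: cmb_def)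
  note p = p wu uw one(2)
  obtain x y z where vw: "v \<cdot> w = cmb x y z" by (rule cmb_exhaust)
  have yz: "y = 0" "z = 0" using right_alt[of v u w] by (simp_all add: p vw cmb_simps)
  obtain x' y' z' where wv: "w \<cdot> v = cmb x' y' z'" by (rule cmb_exhaust)
  have x': "x' = 0" using right_alt[of w u v] by (simp add: p vw wv cmb_simps)
  have xy': "x = 0" "y' = 0" using cyclic[of u w v] by (simp_all add: p vw wv yz x' cmb_simps)
  \<comment> \<open>Now w v = z' w, and right multiplication by the idempotent v is
    idempotent.\<close>
  have "z' * z' = z'" using idem_right[OF orth(2), of w] by (simp add: p vw wv yz x' xy' cmb_simps)
  then consider "z' = 0" | "z' = 1" by auto
  then show ?thesis
  proof cases
    case 1
    show ?thesis
      by (rule classifiedI[OF _ R15_def, where u = "cmb 1 0 0" and v = "cmb 0 1 0" and w = "cmb 0 0 1"])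
      (auto simp: table_simps indep3_def cmb_simps p vw wv yz x' xy' 1)
  next
    case 2
    show ?thesis
      by (rule classifiedI[OF _ R11_def, where u = "cmb 1 0 0" and v = "cmb 0 1 0" and w = "cmb 0 0 1"])
      (auto simp: table_simps indep3_def cmb_simps p vw wv yz x' xy' 2)
  qed
qed

lemma orthogonal_01:
  assumes orth: "u \<cdot> u = u" "v \<cdot> v = v" "u \<cdot> v = 0" "v \<cdot> u = 0" 
    and w: "P01 u w"
  shows classified
proof -
  have p: "u \<cdot> u = cmb 1 0 0" "v \<cdot> v = cmb 0 1 0" "u \<cdot> v = 0" "v \<cdot> u = 0" and wu: "w \<cdot> u = cmb 0 0 1"
    using orth w by (simp_all add: P01_def cmb_def)
  obtain a c b where uw: "u \<cdot> w = cmb a c b" by (rule cmb_exhaust)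
  have ab: "a = 0" "b = 0" using w by (simp_all add: P01_def P00_def uw p wu cmb_simps)
  note p = p wu uw ab
  obtain x y z where "w \<cdot> v = cmb x y z" by (rule cmb_exhaust)
  then have wv: "w \<cdot> v = 0" using right_alt[of w u v] by (simp add: p cmb_simps)
  obtain x y z where vw: "v \<cdot> w = cmb x y z" by (rule cmb_exhaust)
  have y: "y = - c" using right_alt[of v u w] by (simp add: p wv vw cmb_simps eq_neg_iff_add_eq_0 add.commute)
  have x: "x = 0" using cyclic[of u v w] by (simp add: p wv vw y cmb_simps)
  have z: "z * z = z" and cz: "c * z = c"
    using idem_flexible[OF orth(2), of w] by (simp_all add: p wv vw y x cmb_simps)
  note p = p wv vw y x
  consider "z = 1" | "z = 0" "c = 0" using z cz by auto
  then show ?thesis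
  proof cases
    case 1
    \<comment> \<open>Relative to v the vector w has type 10, so exchanging the two idempotents
      reduces to \<open>orthogonal_10\<close>.\<close>
    have "v \<cdot> w - w = cmb 0 (- c) 0" using vw y x 1 by (simp add: cmb_def)
    then have "P10 v w" by (simp add: P10_def P11_def wv p cmb_simps)
    interpret B: dim3_basis scl mult v u w
      by unfold_locales (rule indep3_swap[OF indep])
    show ?thesis using B.orthogonal_10 orth \<open>P10 v w\<close> by blast
  next
    case 2
    obtain q t r where ww: "w \<cdot> w = cmb q t r" by (rule cmb_exhaust)
    have qr: "q = 0" "r = 0" using right_alt[of w u w] by (simp_all add: p ww 2 cmb_simps)
    have t: "t = 0" using right_alt[of w w v] by (simp add: p ww 2 qr cmb_simps)
    show ?thesis
      by (rule classifiedI[OF _ R16_def, where u = "cmb 1 0 0" and v = "cmb 0 1 0" and w = "cmb 0 0 1"])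
      (auto simp: table_simps indep3_def cmb_simps p 2 ww qr t)
  qed
qed

text \<open>After exchanging u and v, three of the types of w relative to v are settled by earlier
  lemmas. If w has type 00 for both, w w is a multiple of w.\<close>

lemma orthogonal_00:
  assumes orth: "u \<cdot> u = u" "v \<cdot> v = v" "u \<cdot> v = 0" "v \<cdot> u = 0" 
    and w: "P00 u w" "peirce v w"
  shows classified
proof -
  have p: "u \<cdot> u = cmb 1 0 0" "v \<cdot> v = cmb 0 1 0" "u \<cdot> v = 0" "v \<cdot> u = 0" "u \<cdot> w = 0" "w \<cdot> u = 0"
    using orth w by (simp_all add: P00_def cmb_def)
  interpret B: dim3_basis scl mult v u w by unfold_locales (rule indep3_swap[OF indep])
  have orth': "v \<cdot> v = v" "u \<cdot> u = u" "v \<cdot> u = 0" "u \<cdot> v = 0" using orth by simp_all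
  consider "P11 v w" | "P10 v w" | "P01 v w" | "P00 v w" using w unfolding peirce_def by blast
  then show ?thesis
  proof cases
    case 4
    then have z: "v \<cdot> w = 0" "w \<cdot> v = 0" by (simp_all add: P00_def)
    obtain a b c where ww: "w \<cdot> w = cmb a b c" by (rule cmb_exhaust)
    have ab: "a = 0" "b = 0"
      using P00_mult[OF w(1) w(1)] P00_mult[OF 4 4] by (simp_all add: P00_def ww p z cmb_simps)
    show ?thesis
    proof (cases "c = 0")
      case True
      show ?thesis
        by (rule classifiedI[OF _ A01_def[unfolded comm_table_mult_def], where u = "cmb 1 0 0" and v = "cmb 0 1 0" and w = "cmb 0 0 1"])
      (auto simp: table_simps indep3_def cmb_simps p z ww ab True)
    next
      case False
      then show ?thesis
        by (intro classifiedI[OF _ A07_def[unfolded comm_table_mult_def],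
            where u = "cmb 1 0 0" and v = "cmb 0 1 0" and w = "cmb 0 0 (1 / c)"])
          (auto simp: table_simps indep3_def cmb_simps p z ww ab)
    qed
  qed (use B.orthogonal_11[OF orth'] B.orthogonal_10[OF orth'] B.orthogonal_01[OF orth'] in blast)+
qed

subsection \<open>Nil algebras\<close>

text \<open>Products form a bilinear form on the span of u and w with values in the line of v. Its
  symmetric part has rank 1, and k measures the alternating part, which scaling w makes 0 or
  1.\<close>

lemma nilpotent_form_isotropic:
  assumes prods: "u \<cdot> u = v" "u \<cdot> v = 0" "v \<cdot> u = 0" "v \<cdot> v = 0" "v \<cdot> w = 0" "w \<cdot> v = 0"
    and skew: "u \<cdot> w = k \<odot> v" "w \<cdot> u = - k \<odot> v" "w \<cdot> w = 0"
  shows classified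
proof -
  have p: "u \<cdot> u = cmb 0 1 0" "u \<cdot> w = cmb 0 k 0" "w \<cdot> u = cmb 0 (- k) 0"
    by (simp_all add: prods skew cmb_def)
  show ?thesis
  proof (cases "k = 0")
    case True
    show ?thesis
      by (rule classifiedI[OF _ A04_def[unfolded comm_table_mult_def], where u = "cmb 1 0 0" and v = "cmb 0 1 0" and w = "cmb 0 0 1"])
      (auto simp: table_simps indep3_def cmb_simps p prods(2-6) skew(3) True)
  next
    case False
    then show ?thesis
      by (intro classifiedI[OF _ R01_def, where u = "cmb 1 0 0" and v = "cmb 0 1 0" and w = "cmb 0 0 (1 / k)"])
        (auto simp: table_simps indep3_def cmb_simps p prods(2-6) skew(3))
  qed
qed

text \<open>The symmetric part is a hyperbolic plane with isotropic vectors u + w and u - w, whose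
  products are (1 - k) 2v and (1 + k) 2v. Hence the third basis vector 2v and the parameter -
  k.\<close>

lemma nilpotent_form_anisotropic:
  assumes prods: "u \<cdot> u = v" "u \<cdot> v = 0" "v \<cdot> u = 0" "v \<cdot> v = 0" "v \<cdot> w = 0" "w \<cdot> v = 0"
    and skew: "u \<cdot> w = k \<odot> v" "w \<cdot> u = - k \<odot> v" "w \<cdot> w = - v"
  shows classified
proof -
  have p: "u \<cdot> u = cmb 0 1 0" "u \<cdot> w = cmb 0 k 0" "w \<cdot> u = cmb 0 (- k) 0" "w \<cdot> w = cmb 0 (- 1) 0"
    by (simp_all add: prods skew cmb_def)
  have ind: "indep3 (cmb 1 0 1) (cmb 1 0 (- 1)) (cmb 0 2 0)"
    unfolding indep3_def
  proof (intro allI impI)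
    fix a b c assume "a \<odot> cmb 1 0 1 + b \<odot> cmb 1 0 (- 1) + c \<odot> cmb 0 2 0 = 0"
    then have "cmb (a + b) (2 * c) (a - b) = 0" by (simp add: cmb_scale cmb_add mult.commute)
    then have eqs: "a + b = 0" "a - b = 0" "2 * c = 0" unfolding cmb_eq_0 by blast+
    have "2 * a = (a + b) + (a - b)" by simp
    also have "\<dots> = 0" unfolding eqs by simp
    finally have "a = 0" by simp
    with eqs show "a = 0 \<and> b = 0 \<and> c = 0" by simp
  qed
  show ?thesis
  proof (cases "k = 0")
    case True
    show ?thesis
      by (rule classifiedI[OF _ A05_def[unfolded comm_table_mult_def] ind])
        (auto simp: table_simps cmb_simps p prods(2-6) True)
  next
    case False
    then show ?thesis
      by (intro classifiedI[OF _ R02_def[of "- k"] ind])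
        (auto simp: table_simps cmb_simps p prods(2-6))
  qed
qed

text \<open>Orthogonalisation: s and k come from the symmetric and alternating parts, n is
  orthogonal to u for the symmetric part, and d is the value of its square.\<close>

lemma nilpotent_form:
  assumes prods: "u \<cdot> u = v" "u \<cdot> v = 0" "v \<cdot> u = 0" "v \<cdot> v = 0" "v \<cdot> w = 0" "w \<cdot> v = 0"
    and form: "u \<cdot> w = a \<odot> v" "w \<cdot> u = b \<odot> v" "w \<cdot> w = c \<odot> v"
  shows classified
proof -
  define s where "s = (a + b) / 2"
  define k where "k = (a - b) / 2"
  define d where "d = c - s * s"
  define n where "n = w - s \<odot> u"
  have ab: "a = s + k" "b = s - k" by (simp_all add: s_def k_def field_simps)
  have n: "u \<cdot> n = k \<odot> v" "n \<cdot> u = - k \<odot> v" "n \<cdot> n = d \<odot> v" "v \<cdot> n = 0" "n \<cdot> v = 0"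
    by (simp_all add: n_def d_def prods form ab scale_left_distrib scale_right_distrib
        scale_left_diff_distrib scale_right_diff_distrib algebra_simps)
  have "indep3 (cmb 1 0 0) (cmb 0 1 0) (r \<odot> cmb (- s) 0 1)" if "r \<noteq> 0" for r
    using that by (auto simp: indep3_def cmb_simps)
  moreover have "n = cmb (- s) 0 1" "u = cmb 1 0 0" "v = cmb 0 1 0" by (simp_all add: n_def cmb_def)
  ultimately have ind: "indep3 u v (r \<odot> n)" if "r \<noteq> 0" for r using that by metis
  show ?thesis
  proof (cases "d = 0")
    case True
    interpret B: dim3_basis scl mult u v n by unfold_locales (use ind[of 1] in simp)
    show ?thesis by (rule B.nilpotent_form_isotropic[of k]) (simp_all add: prods n True)
  next
    case False
    \<comment> \<open>Division by r gives n the square - v, so that its sum with u is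
      isotropic.\<close>
    define r where "r = csqrt (- d)"
    have r: "r \<noteq> 0" "d = - (r * r)" using False by (auto simp: r_def simp flip: power2_eq_square)
    interpret B: dim3_basis scl mult u v "(1 / r) \<odot> n" by unfold_locales (rule ind, use r in simp)
    show ?thesis by (rule B.nilpotent_form_anisotropic[of "k / r"]) (use r in \<open>simp_all add: prods n\<close>)
  qed
qed

text \<open>Vanishing cubes make every right multiplication nilpotent. With the linearised cube this
  forces all products into the line of v and makes v annihilate everything.\<close>

lemma cubes_zero_form:
  assumes cube: "\<And>x. x \<cdot> x \<cdot> x = 0" and sq: "u \<cdot> u = v"
  shows classified
proof -
  have p: "u \<cdot> u = cmb 0 1 0" "v \<cdot> u = 0" "u \<cdot> v = 0" "v \<cdot> v = 0"
    using cube[of u] right_alt_square[of u u] right_alt_square[of v u] by (simp_all add: sq cmb_def)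
  have nil: "y \<cdot> x \<cdot> x \<cdot> x = 0" for x y using right_mult_cube[of y x] cube by simp
  obtain \<alpha> \<beta> \<gamma> where wu: "w \<cdot> u = cmb \<alpha> \<beta> \<gamma>" by (rule cmb_exhaust)
  \<comment> \<open>\<gamma> is the eigenvalue of the nilpotent R_u modulo the span of u and
    v.\<close>
  have \<gamma>: "\<gamma> = 0" using nil[of w u] by (auto simp: p wu cmb_simps)
  have wv: "w \<cdot> v = cmb 0 \<alpha> 0" using right_alt_square[of w u] by (simp add: p wu \<gamma> cmb_simps)
  obtain l m n where uw: "u \<cdot> w = cmb l m n" by (rule cmb_exhaust)
  \<comment> \<open>Adding the cubes of w + u and w - u isolates the part of the linearised cube
    that is quadratic in u and linear in w.\<close>
  have "(u + w) \<cdot> (u + w) \<cdot> (u + w) + (w - u) \<cdot> (w - u) \<cdot> (w - u) =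
    (u \<cdot> u \<cdot> w + u \<cdot> w \<cdot> u + w \<cdot> u \<cdot> u) + (u \<cdot> u \<cdot> w + u \<cdot> w \<cdot> u + w \<cdot> u \<cdot> u)
      + (w \<cdot> w \<cdot> w + w \<cdot> w \<cdot> w)"
    by (simp add: algebra_simps)
  then have "(u \<cdot> u \<cdot> w + u \<cdot> w \<cdot> u + w \<cdot> u \<cdot> u) + (u \<cdot> u \<cdot> w + u \<cdot> w \<cdot> u + w \<cdot> u \<cdot> u) = 0 + 0"
    by (simp only: cube add_0_right)
  from double_cancel[OF this] have lin: "v \<cdot> w + (u \<cdot> w \<cdot> u + w \<cdot> u \<cdot> u) = 0"
    by (simp only: sq add.assoc)
  obtain x y z where vw: "v \<cdot> w = cmb x y z" by (rule cmb_exhaust)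
  have "x + n * \<alpha> = 0 \<and> y + (l + (n * \<beta> + \<alpha>)) = 0 \<and> z = 0"
    using lin by (simp add: p wu wv uw vw \<gamma> cmb_simps add.assoc)
  then have xyz: "x = - (n * \<alpha>)" "y = - (l + (n * \<beta> + \<alpha>))" "z = 0"
    unfolding eq_neg_iff_add_eq_0 by blast+
  have n: "n = 0" using right_alt[of u u w] by (auto simp: p wu wv uw vw \<gamma> xyz cmb_simps)
  have l: "l = - 2 * \<alpha>" using right_alt[of u u w]
    by (simp add: p wu wv uw vw \<gamma> xyz n cmb_simps) (simp add: algebra_simps eq_neg_iff_add_eq_0)
  have \<alpha>: "\<alpha> = 0" using nil[of v w] by (simp add: p wu wv uw vw \<gamma> xyz n l cmb_simps)
  obtain a b c where ww: "w \<cdot> w = cmb a b c" by (rule cmb_exhaust)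
  note p = p wu wv uw vw \<gamma> xyz n l \<alpha> ww
  have c: "c = 0" using cube[of w] by (auto simp: p cmb_simps)
  have a: "a = 0" using right_alt_square[of u w] by (auto simp: p c cmb_simps)
  show ?thesis
    by (rule nilpotent_form[of m \<beta> b]) (simp_all add: p sq a c cmb_def)
qed

end

context dim3_algebra
begin

subsection \<open>Classification\<close>

text \<open>Steinitz exchange keeping u, so that the third basis vector can be retained from a
  Peirce basis.\<close>

lemma indep3_exchange:
  assumes i: "indep3 u x y" and v: "\<And>k. v \<noteq> k \<odot> u"
  shows "indep3 u v x \<or> indep3 u v y"
proof -
  interpret B: dim3_basis scl mult u x y by unfold_locales (rule i)
  obtain a b c where vc: "v = B.cmb a b c" by (rule B.cmb_exhaust)
  have bas: "u = B.cmb 1 0 0" "x = B.cmb 0 1 0" "y = B.cmb 0 0 1" by (simp_all add: B.cmb_def)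
  have "b \<noteq> 0 \<or> c \<noteq> 0" using v[of a] vc by (auto simp: B.cmb_def)
  moreover have "indep3 (B.cmb 1 0 0) (B.cmb a b c) (B.cmb 0 1 0)" if "c \<noteq> 0"
    using that by (auto simp: indep3_def B.cmb_simps)
  moreover have "indep3 (B.cmb 1 0 0) (B.cmb a b c) (B.cmb 0 0 1)" if "b \<noteq> 0"
    using that by (auto simp: indep3_def B.cmb_simps)
  ultimately show ?thesis using bas vc by metis
qed

text \<open>Here u is a unit, and every element is a scalar plus an element of cube zero. Either
  such an element has nonzero square, or squares of shifted sums and differences force
  anticommutativity.\<close>

lemma peirce_11_11_classified:
  assumes uu: "u \<cdot> u = u" and no: no_orthogonal_idempotents
    and ind: "indep3 u v w" and v: "P11 u v" and w: "P11 u w"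
  shows classified
proof -
  interpret dim3_basis scl mult u v w by unfold_locales (rule ind)
  have unit: "u \<cdot> x = x" "x \<cdot> u = x" for x
  proof -
    obtain a b c where "x = cmb a b c" by (rule cmb_exhaust)
    then show "u \<cdot> x = x" "x \<cdot> u = x"
      using uu v w by (simp_all add: cmb_def P11_def)
  qed
  have shift: "\<exists>k. (x - k \<odot> u) \<cdot> (x - k \<odot> u) \<cdot> (x - k \<odot> u) = 0" for x
  proof (cases "indep3 u x (x \<cdot> x)")
    case True
    then interpret B: dim3_basis scl mult u x "x \<cdot> x" by unfold_locales
    show ?thesis using B.unital_cubic_shift[OF unit no refl] by blast
  next
    case False
    show ?thesis
    proof (cases "\<exists>c. x = c \<odot> u")
      case True
      then obtain c where "x - c \<odot> u = 0" by auto
      then show ?thesis by (intro exI[of _ c]) (simp only: mult_linear)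
    next
      case not_scalar: False
      obtain a b c where rel: "a \<odot> u + b \<odot> x + c \<odot> (x \<cdot> x) = 0" "a \<noteq> 0 \<or> b \<noteq> 0 \<or> c \<noteq> 0"
        using False unfolding indep3_def by blast
      have "c \<noteq> 0"
      proof
        assume c: "c = 0"
        have "b \<noteq> 0" using rel c u_nonzero by auto
        from rel(1) c have "b \<odot> x = (- a) \<odot> u"
          by (metis add.right_neutral eq_neg_iff_add_eq_0 add.commute scale_zero_left scale_minus_left)
        then have "(1 / b) \<odot> (b \<odot> x) = (1 / b) \<odot> ((- a) \<odot> u)" by simp
        then have "x = (- a / b) \<odot> u" using \<open>b \<noteq> 0\<close> by simp
        then show False using not_scalar by blast
      qed
      from rel(1) have "c \<odot> (x \<cdot> x) = (- a) \<odot> u + (- b) \<odot> x"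
        by (metis add.commute eq_neg_iff_add_eq_0 minus_add_distrib scale_minus_left)
      then have "(1 / c) \<odot> (c \<odot> (x \<cdot> x)) = (1 / c) \<odot> ((- a) \<odot> u + (- b) \<odot> x)" by simp
      then have "x \<cdot> x = (1 / c) \<odot> ((- a) \<odot> u + (- b) \<odot> x)" using \<open>c \<noteq> 0\<close> by simp
      then have xx: "x \<cdot> x = (- a / c) \<odot> u + (2 * (- b / (2 * c))) \<odot> x"
        by (simp add: scale_right_diff_distrib)
      \<comment> \<open>Completing the square in the quadratic relation for x.\<close>
      define p k where "p = - a / c" and "k = - b / (2 * c)"
      define n where "n = x - k \<odot> u"
      have "n \<cdot> n = p \<odot> u + (2 * k) \<odot> x - k \<odot> x - (k \<odot> x - (k * k) \<odot> u)"
        using xx unfolding p_def[symmetric] k_def[symmetric]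
        by (simp add: n_def unit scale_right_diff_distrib)
      also have "\<dots> = (p + k * k) \<odot> u"
        by (simp add: scale_left_distrib scale_double)
      finally have nn: "n \<cdot> n = (p + k * k) \<odot> u" .
      have "n \<noteq> c \<odot> u" for c
      proof
        assume "n = c \<odot> u"
        then have "x = (c + k) \<odot> u" by (simp add: n_def diff_eq_eq scale_left_distrib)
        then show False using not_scalar by blast
      qed
      moreover have "P11 u n" by (simp add: P11_def unit)
      ultimately have "p + k * k = 0" using unital_square_zero[OF uu no _ nn] by blast
      with nn show ?thesis by (intro exI[of _ k]) (simp add: n_def[symmetric])
    qed
  qed
  obtain k k' where k: "(v - k \<odot> u) \<cdot> (v - k \<odot> u) \<cdot> (v - k \<odot> u) = 0"
    "(w - k' \<odot> u) \<cdot> (w - k' \<odot> u) \<cdot> (w - k' \<odot> u) = 0" using shift by blast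
  define n m where "n = v - k \<odot> u" and "m = w - k' \<odot> u"
  have "n = cmb (- k) 1 0" "m = cmb (- k') 0 1" "u = cmb 1 0 0" by (simp_all add: n_def m_def cmb_def)
  moreover have "indep3 (cmb 1 0 0) (cmb (- k) 1 0) (cmb (- k') 0 1)"
    by (auto simp: indep3_def cmb_simps)
  ultimately have "indep3 u n m" by metis
  then interpret B: dim3_basis scl mult u n m by unfold_locales
  show ?thesis
  proof (cases "\<exists>x. x \<cdot> x \<cdot> x = 0 \<and> x \<cdot> x \<noteq> 0")
    case True
    then show ?thesis using unital_cube_zero_square_nonzero[OF unit] by blast
  next
    case False
    then have sq: "n \<cdot> n = 0" "m \<cdot> m = 0" using k unfolding n_def m_def by blast+
    obtain h h' where
      h: "(n + m - h \<odot> u) \<cdot> (n + m - h \<odot> u) = 0" "(n - m - h' \<odot> u) \<cdot> (n - m - h' \<odot> u) = 0"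
      using False shift by metis
    obtain a b c where nm: "n \<cdot> m + m \<cdot> n = B.cmb a b c" by (rule B.cmb_exhaust)
    have q: "(n + m - h \<odot> u) \<cdot> (n + m - h \<odot> u) = (n \<cdot> m + m \<cdot> n) + B.cmb (h * h) (- 2 * h) (- 2 * h)"
      by (simp add: sq unit B.cmb_def scale_double scale_right_diff_distrib scale_right_distrib add.assoc add.left_commute add.commute diff_add_eq diff_diff_add diff_diff_eq2 add_diff_eq)
    have q': "(n - m - h' \<odot> u) \<cdot> (n - m - h' \<odot> u) = B.cmb (h' * h') (- 2 * h') (2 * h') - (n \<cdot> m + m \<cdot> n)"
      by (simp add: sq unit B.cmb_def scale_double scale_right_diff_distrib scale_right_distrib add.assoc add.left_commute add.commute diff_add_eq diff_diff_add diff_diff_eq2 add_diff_eq)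
    have "B.cmb (a + h * h) (b - 2 * h) (c - 2 * h) = 0"
      using h(1) unfolding q nm B.cmb_add by simp
    moreover have "B.cmb (h' * h' - a) (- 2 * h' - b) (2 * h' - c) = 0"
      using h(2) unfolding q' nm B.cmb_diff by simp
    ultimately have eqs: "a + h * h = 0" "b - 2 * h = 0" "c - 2 * h = 0"
      "- 2 * h' - b = 0" "2 * h' - c = 0"
      unfolding B.cmb_eq_0 by blast+
    \<comment> \<open>The equations say b = 2h = -2h' and c = 2h = 2h'.\<close>
    have "4 * h = (c - 2 * h') - (- 2 * h' - b) - (b - 2 * h) - (c - 2 * h)" by simp
    then have "h = 0" using eqs by simp
    with eqs have "a = 0" "b = 0" "c = 0" by simp_all
    then have "n \<cdot> m + m \<cdot> n = 0" by (auto simp: nm B.cmb_simps)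
    from B.unital_anticommuting[OF unit sq this] show ?thesis .
  qed
qed

text \<open>A Peirce basis for u supplies the third vector. If it lies in A_00 of u, that component
  is decomposed again under v, so that the third vector has a type for both idempotents.\<close>

lemma orthogonal_idempotents_classified:
  assumes orth: "u \<cdot> u = u" "v \<cdot> v = v" "u \<cdot> v = 0" "v \<cdot> u = 0" and nz: "u \<noteq> 0" "v \<noteq> 0"
  shows classified
proof -
  have "v \<noteq> k \<odot> u" for k
  proof
    assume v: "v = k \<odot> u"
    then have "k \<odot> u = 0" using orth by simp
    with v nz show False by simp
  qed
  moreover obtain x y where "peirce u x" "peirce u y" "indep3 u x y"
    using peirce_basis[OF orth(1) nz(1)] .
  ultimately obtain w where w: "peirce u w" "indep3 u v w"
    using indep3_exchange by metis
  interpret dim3_basis scl mult u v w by unfold_locales (rule w(2))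
  consider "P11 u w" | "P10 u w" | "P01 u w" | "P00 u w" using w unfolding peirce_def by blast
  then show ?thesis
  proof cases
    case 4
    let ?S = "Collect (P00 u)"
    have sub: "subspace ?S" by (rule subspaceI) (simp_all add: P00_def)
    have v: "P00 u v" using orth by (simp add: P00_def)
    have span: "x \<in> span (Collect (peirce v) \<inter> ?S)" if "P00 u x" for x
      by (rule peirce_span[OF orth(2) sub]) (use that v P00_mult in auto)
    let ?T = "insert u (Collect (peirce v) \<inter> ?S)"
    have "cmb a b c \<in> span ?T" for a b c
      unfolding cmb_def using span[OF v] span[OF 4] span_mono[of "Collect (peirce v) \<inter> ?S" ?T]
      by (intro span_add span_scale) (auto intro: span_base)
    then have T: "span ?T = UNIV" by (metis UNIV_eq_I cmb_exhaust)
    obtain y z where yz: "y \<in> ?T" "z \<in> ?T" "indep3 u y z"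
      using span_contains_indep3[OF _ nz(1) T] by auto
    have "v \<noteq> k \<odot> u" for k by fact
    then obtain w' where w': "w' \<in> ?T" "indep3 u v w'"
      using indep3_exchange[OF yz(3)] yz by metis
    then have "w' \<noteq> u" using indep3_distinct by blast
    with w' have *: "P00 u w'" "peirce v w'" by auto
    interpret B: dim3_basis scl mult u v w' by unfold_locales (rule w'(2))
    show ?thesis by (rule B.orthogonal_00[OF orth *])
  qed (use orthogonal_11[OF orth] orthogonal_10[OF orth] orthogonal_01[OF orth] in blast)+
qed

lemma nil_cube_nonzero:
  assumes "x \<cdot> x \<cdot> x \<noteq> 0" "x \<cdot> x \<cdot> x \<cdot> x = 0"
  shows classified
proof -
  have ind: "indep3 x (x \<cdot> x) (x \<cdot> x \<cdot> x)"
    unfolding indep3_def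
  proof (intro allI impI)
    fix a b c assume rel: "a \<odot> x + b \<odot> (x \<cdot> x) + c \<odot> (x \<cdot> x \<cdot> x) = 0"
    have 1: "a \<odot> (x \<cdot> x) + b \<odot> (x \<cdot> x \<cdot> x) = 0"
      using arg_cong[OF rel, of "\<lambda>y. y \<cdot> x"] assms by simp
    have "a = 0"
      using arg_cong[OF 1, of "\<lambda>y. y \<cdot> x"] assms by simp
    with 1 rel assms show "a = 0 \<and> b = 0 \<and> c = 0" by simp
  qed
  show ?thesis
    by (rule classifiedI[OF _ A06_def[unfolded comm_table_mult_def] ind])
      (simp_all add: table_simps right_mult_cube assms flip: right_alt_square)
qed

text \<open>Multiplication is anticommutative, and right multiplications by x and y kill x y; they
  therefore separate x, y and x y.\<close>

lemma nil_squares_zero: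
  assumes sq: "\<And>x. x \<cdot> x = 0" and xy: "x \<cdot> y \<noteq> 0"
  shows classified
proof -
  have anti: "x \<cdot> y + y \<cdot> x = 0" for x y using sq[of "x + y"] unfolding mult_linear by (simp add: sq add.commute)
  then have neg: "y \<cdot> x = - (x \<cdot> y)" for x y by (simp add: eq_neg_iff_add_eq_0 add.commute)
  have zero: "x \<cdot> y \<cdot> x = 0" "x \<cdot> y \<cdot> y = 0" for x y
    using anticommuting_right_zero[OF sq anti] right_alt_square[of x y] sq by simp_all
  have ind: "indep3 x y (x \<cdot> y)"
    unfolding indep3_def
  proof (intro allI impI)
    fix a b c assume rel: "a \<odot> x + b \<odot> y + c \<odot> (x \<cdot> y) = 0"
    have a: "a = 0" using arg_cong[OF rel, of "\<lambda>z. z \<cdot> y"] xy by (simp add: sq zero)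
    have b: "b = 0" using arg_cong[OF rel, of "\<lambda>z. z \<cdot> x"] xy by (simp add: sq zero neg[of y x] a)
    show "a = 0 \<and> b = 0 \<and> c = 0" using rel a b xy by simp
  qed
  have "x \<cdot> (x \<cdot> y) = 0" "y \<cdot> (x \<cdot> y) = 0"
    using zero[of x y] neg[of "x \<cdot> y" x] neg[of "x \<cdot> y" y] by simp_all
  then show ?thesis
    by (intro classifiedI[OF _ R00_def ind])
      (simp_all add: table_simps sq zero neg[of y x])
qed

lemma nil_classified:
  assumes nil: "\<And>x. x \<cdot> x \<cdot> x \<cdot> x = 0" and "x \<cdot> y \<noteq> 0"
  shows classified
proof -
  consider (cube) z where "z \<cdot> z \<cdot> z \<noteq> 0" | (zero) "\<And>z. z \<cdot> z = 0"
    | (square) z where "\<And>z. z \<cdot> z \<cdot> z = 0" "z \<cdot> z \<noteq> 0" by metis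
  then show ?thesis
  proof cases
    case cube
    then show ?thesis using nil nil_cube_nonzero by blast
  next
    case zero
    then show ?thesis using nil_squares_zero assms(2) by blast
  next
    case (square z)
    then have "z \<noteq> 0" by auto
    then obtain p q where pq: "indep3 z p q"
      using span_contains_indep3[of z UNIV] by auto
    have "z \<cdot> z \<noteq> k \<odot> z" for k
    proof
      assume k: "z \<cdot> z = k \<odot> z"
      then have "z \<cdot> z \<cdot> z = (k * k) \<odot> z" by simp
      then have "k = 0" using square(1)[of z] \<open>z \<noteq> 0\<close> by simp
      with k square(2) show False by simp
    qed
    then obtain w where "indep3 z (z \<cdot> z) w" using indep3_exchange[OF pq] by blast
    then interpret B: dim3_basis scl mult z "z \<cdot> z" w by unfold_locales
    show ?thesis using B.cubes_zero_form[OF square(1) refl] .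
  qed
qed

text \<open>Four Peirce types give ten unordered pairs; interpreting the basis with its last two
  vectors exchanged covers both orders.\<close>

lemma idempotent_classified:
  assumes u: "u \<cdot> u = u" "u \<noteq> 0"
  shows classified
proof (cases no_orthogonal_idempotents)
  case False
  then show ?thesis
    using orthogonal_idempotents_classified unfolding no_orthogonal_idempotents_def by blast
next
  case no: True
  obtain v w where vw: "peirce u v" "peirce u w" "indep3 u v w" using peirce_basis[OF u] .
  have ind': "indep3 u w v" using vw(3) unfolding indep3_def by (metis add.assoc add.commute)
  interpret B: dim3_basis scl mult u v w by unfold_locales (rule vw(3))
  interpret C: dim3_basis scl mult u w v by unfold_locales (rule ind')
  have c11: classified
    if ab: "P11 u a" "P00 u b \<or> P10 u b \<or> P01 u b" "indep3 u a b" for a b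
  proof -
    interpret D: dim3_basis scl mult u a b by unfold_locales (rule ab(3))
    \<comment> \<open>For type 01 the operator R is the identity on the basis, so u b, which lies in
      A_00, is zero.\<close>
    have r: "b \<cdot> u = 0 \<or> u \<cdot> b = 0"
    proof -
      obtain x y z where ub: "u \<cdot> b = D.cmb x y z" by (rule D.cmb_exhaust)
      have "u \<cdot> b = 0" if "P01 u b"
        using that \<open>P11 u a\<close> u ub unfolding P01_def P00_def P11_def
        by (metis D.cmb_def D.cmb_mult(1))
      then show ?thesis using ab(2) by (auto simp: P00_def P10_def)
    qed
    obtain n where n: "P11 u n" "n \<cdot> n = 0" "indep3 u n b"
      using D.nilpotent_P11_vector[OF u(1) no ab(1) r] .
    interpret E: dim3_basis scl mult u n b by unfold_locales (rule n(3))
    show ?thesis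
      using E.peirce_11_00_classified[OF u(1) no n(1)] E.peirce_11_10_classified[OF u(1) no n(1)] E.peirce_11_01_classified[OF u(1) no n(1)]
        n(2) ab(2) by blast
  qed
  show ?thesis
    using vw(1,2) c11[OF _ _ vw(3)] c11[OF _ _ ind'] peirce_11_11_classified[OF u(1) no vw(3)]
      B.peirce_00_00_classified[OF u(1) no] B.peirce_00_10_classified[OF u(1) no] C.peirce_00_10_classified[OF u(1) no]
      B.peirce_00_01_classified[OF u(1) no] C.peirce_00_01_classified[OF u(1) no] B.peirce_10_10_classified[OF u(1) no]
      B.peirce_01_01_classified[OF u(1) no] B.peirce_10_01_classified[OF u(1) no] C.peirce_10_01_classified[OF u(1) no]
    unfolding peirce_def by blast
qed

end

theorem corollary16:
  fixes scl :: "complex \<Rightarrow> 'a::ab_group_add \<Rightarrow> 'a"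
    and mult :: "'a \<Rightarrow> 'a \<Rightarrow> 'a"
  assumes "minus_one_one_algebra scl mult"
    and "vector_space.dim scl (UNIV :: 'a set) = 3"
    and "\<exists>x y. mult x y \<noteq> 0"
  shows "\<exists>B \<in> listed_algebras. algebra_isomorphic scl mult vector_scalar_mult B"
proof -
  interpret dim3_algebra scl mult
    using assms(1,2) by (intro dim3_algebra.intro dim3_algebra_axioms.intro)
  have classified
    using nil_classified idempotent_classified idempotent_of_not_nil assms(3) by metis
  then show ?thesis unfolding classified_def .
qed

end
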